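(* Let $k\in\mathbb{N}$ and $n_1,\dots,n_k\in\{2,3,4,\dots\}$ with $n_1-1\mid n_j-1$ for all $j\in\{1,\dots,k\}$. There exists a fixed $d\in\mathbb{N}$ such that for every $w\in F(n_1,\dots,n_k)$, $$|w|_X\le d\,L(w).$$
   Context: $F(n_1,\dots,n_k)$ is the group (product $xy=x\circ y$) of piecewise-linear orientation-preserving homeomorphisms of $[0,1]$ with finitely many breakpoints, all in $\mathbb{Z}[\frac{1}{n_1\cdots n_k}]$, and slopes in the multiplicative group $\langle n_1,\dots,n_k\rangle$. An $n$-ary caret (caret of type $n$) has one parent vertex joined by $n$ edges to $n$ child vertices, ordered from left to right. An $(n_1,\dots,n_k)$-ary tree is a rooted tree formed from finitely many (possibly zero) carets of types in $\{n_1,\dots,n_k\}$ by identifying child vertices of carets with parent vertices of other carets. Leaves are numbered $0,1,2,\dots$ from left to right. The root represents $[0,1]$, and the children of an $n$-ary caret represent, from left to right, the $n$ equal consecutive closed subintervals of the parent's interval. A tree-pair diagram $(T_-,T_+)$ is an ordered pair of such trees with equally many leaves (domain tree $T_-$, range tree $T_+$); it represents the element mapping the $i$th leaf interval of $T_-$ affinely and increasingly onto the $i$th leaf interval of $T_+$, for all $i$. Every element is represented by some diagram. A diagram is minimal if it has the fewest leaves among all diagrams representing the same element; $L(x)$ is the number of leaves in either tree of a minimal diagram for $x$. Generators. A right $n_1$-string is a tree all of whose carets are of type $n_1$ and have an edge on the rightmost root-to-leaf path. For $j\in\{2,\dots,k\}$, $i\ge0$, $(y_j)_i$ has range tree a right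 $n_1$-string of $i$ carets with an $n_j$-ary caret attached to its last leaf, and domain tree the right $n_1$-string with the same number of leaves. For $j\in\{1,\dots,k\}$, $i\ge 0$, $(z_j)_i$ has range tree a right $n_1$-string of $\lfloor i/(n_1-1)\rfloor+1$ carets with an $n_j$-ary caret attached to the leaf numbered $i$, and domain tree the right $n_1$-string with the same number of leaves. The standard finite generating set is $X=\{(y_i)_0,\dots,(y_i)_{n_i-1}: 2\le i\le k\}\cup\{(z_j)_0,\dots,(z_j)_{n_j-1}:1\le j\le k\}$, and $|x|_X$ is the word length of $x$ with respect to $X$. *)

theory Defs
  imports "HOL-Analysis.Analysis" "HOL-Algebra.Bij" "HOL-Library.Extended_Nat"
begin

section \<open>The group \<open>F(n\<^sub>1, \<dots>, n\<^sub>k)\<close>\<close>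

text \<open>
  Throughout, \<open>n 1, \<dots>, n k\<close> are the parameters; other values of \<open>n\<close> are irrelevant.
\<close>

definition breakpoint_ring :: "nat \<Rightarrow> (nat \<Rightarrow> nat) \<Rightarrow> real set" where
  "breakpoint_ring k n = {of_int a / of_nat (\<Prod>j=1..k. n j) ^ e | (a :: int) (e :: nat). True}"

definition slope_group :: "nat \<Rightarrow> (nat \<Rightarrow> nat) \<Rightarrow> real set" where
  "slope_group k n = {\<Prod>j=1..k. real (n j) powi e j | e :: nat \<Rightarrow> int. True}"

text \<open>
  \<open>B\<close> is a finite set that contains all breakpoints of \<open>f\<close>: on every subinterval whose interior
  misses \<open>B\<close>, \<open>f\<close> is affine.
\<close>

definition piecewise_linear_with :: "real set \<Rightarrow> real set \<Rightarrow> (real \<Rightarrow> real) \<Rightarrow> bool" where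
  "piecewise_linear_with R S f \<longleftrightarrow>
     (\<exists>B. finite B \<and> B \<subseteq> R \<and>
       (\<forall>a b. 0 \<le> a \<and> a < b \<and> b \<le> 1 \<and> {a<..<b} \<inter> B = {} \<longrightarrow>
         (\<exists>m\<in>S. \<forall>t\<in>{a..b}. f t = f a + m * (t - a))))"

definition F_carrier :: "nat \<Rightarrow> (nat \<Rightarrow> nat) \<Rightarrow> (real \<Rightarrow> real) set" where
  "F_carrier k n = {f \<in> Bij {0..1}.
     (\<exists>g. homeomorphism {0..1} {0..1} f g) \<and> strict_mono_on {0..1} f \<and>
     piecewise_linear_with (breakpoint_ring k n) (slope_group k n) f}"

text \<open>
  In \<^const>\<open>BijGroup\<close> the product of \<open>x\<close> and \<open>y\<close> is the composite \<open>x \<circ> y\<close>; its elements are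
  \<^const>\<open>undefined\<close> outside \<open>[0,1]\<close>, so that equality in the group is equality on \<open>[0,1]\<close>.
\<close>

definition F :: "nat \<Rightarrow> (nat \<Rightarrow> nat) \<Rightarrow> (real \<Rightarrow> real) monoid" where
  "F k n = (BijGroup {0..1}) \<lparr>carrier := F_carrier k n\<rparr>"

section \<open>Trees and tree-pair diagrams\<close>

text \<open>\<open>Caret ts\<close> is a caret of type \<open>length ts\<close> with the trees \<open>ts\<close> attached to its children.\<close>

datatype tree = Leaf | Caret "tree list"

fun tree_of_types :: "nat set \<Rightarrow> tree \<Rightarrow> bool" where
  "tree_of_types N Leaf \<longleftrightarrow> True"
| "tree_of_types N (Caret ts) \<longleftrightarrow> length ts \<in> N \<and> (\<forall>t\<in>set ts. tree_of_types N t)"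

fun num_leaves :: "tree \<Rightarrow> nat" where
  "num_leaves Leaf = 1"
| "num_leaves (Caret ts) = sum_list (map num_leaves ts)"

lemma size_nth_less [termination_simp]: "i < length ts \<Longrightarrow> size (ts ! i) < Suc (size_list size ts)"
  using size_list_estimation'[OF nth_mem order_refl, of i ts size] by simp

text \<open>
  The leaf intervals, from left to right, as pairs of endpoints, of a tree whose root represents
  \<open>[a,b]\<close>.
\<close>

fun leaf_intervals :: "tree \<Rightarrow> real \<Rightarrow> real \<Rightarrow> (real \<times> real) list" where
  "leaf_intervals Leaf a b = [(a, b)]"
| "leaf_intervals (Caret ts) a b =
     concat (map (\<lambda>i. leaf_intervals (ts ! i)
         (a + real i * (b - a) / real (length ts))
         (a + real (Suc i) * (b - a) / real (length ts)))
       [0..<length ts])"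

text \<open>\<open>S\<close> is the domain tree and \<open>T\<close> the range tree.\<close>

definition represents :: "tree \<Rightarrow> tree \<Rightarrow> (real \<Rightarrow> real) \<Rightarrow> bool" where
  "represents S T f \<longleftrightarrow>
     num_leaves S = num_leaves T \<and> f \<in> extensional {0..1} \<and>
     (\<forall>i < num_leaves S.
       let (a, b) = leaf_intervals S 0 1 ! i; (c, d) = leaf_intervals T 0 1 ! i
       in \<forall>t\<in>{a..b}. f t = c + (d - c) / (b - a) * (t - a))"

definition diagram_map :: "tree \<Rightarrow> tree \<Rightarrow> (real \<Rightarrow> real)" where
  "diagram_map S T = (THE f. represents S T f)"

definition L :: "nat \<Rightarrow> (nat \<Rightarrow> nat) \<Rightarrow> (real \<Rightarrow> real) \<Rightarrow> nat" where
  "L k n x = (LEAST l. \<exists>S T. tree_of_types (n ` {1..k}) S \<and> tree_of_types (n ` {1..k}) T \<and>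
                        represents S T x \<and> num_leaves S = l)"

section \<open>The standard finite generating set\<close>

fun right_string :: "nat \<Rightarrow> nat \<Rightarrow> tree" where
  "right_string m 0 = Leaf"
| "right_string m (Suc i) = Caret (replicate (m - 1) Leaf @ [right_string m i])"

text \<open>Attach the tree \<open>c\<close> to the leaf numbered \<open>i\<close>.\<close>

fun attach :: "nat \<Rightarrow> tree \<Rightarrow> tree \<Rightarrow> tree"
  and attach_list :: "nat \<Rightarrow> tree \<Rightarrow> tree list \<Rightarrow> tree list" where
  "attach i c Leaf = (if i = 0 then c else Leaf)"
| "attach i c (Caret ts) = Caret (attach_list i c ts)"
| "attach_list i c [] = []"
| "attach_list i c (t # ts) =
     (if i < num_leaves t then attach i c t # ts
      else t # attach_list (i - num_leaves t) c ts)"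

definition caret :: "nat \<Rightarrow> tree" where
  "caret m = Caret (replicate m Leaf)"

text \<open>
  A right \<open>m\<close>-string with \<open>p\<close> carets has \<open>p * (m - 1) + 1\<close> leaves, so the domain tree below has the
  same number of leaves as \<open>T\<close> whenever \<open>m - 1\<close> divides \<open>num_leaves T - 1\<close>.
\<close>

definition with_right_string_domain :: "nat \<Rightarrow> tree \<Rightarrow> (real \<Rightarrow> real)" where
  "with_right_string_domain m T = diagram_map (right_string m ((num_leaves T - 1) div (m - 1))) T"

definition y_gen :: "(nat \<Rightarrow> nat) \<Rightarrow> nat \<Rightarrow> nat \<Rightarrow> (real \<Rightarrow> real)" where
  "y_gen n j i = with_right_string_domain (n 1)
     (let R = right_string (n 1) i in attach (num_leaves R - 1) (caret (n j)) R)"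

definition z_gen :: "(nat \<Rightarrow> nat) \<Rightarrow> nat \<Rightarrow> nat \<Rightarrow> (real \<Rightarrow> real)" where
  "z_gen n j i = with_right_string_domain (n 1)
     (attach i (caret (n j)) (right_string (n 1) (i div (n 1 - 1) + 1)))"

definition X :: "nat \<Rightarrow> (nat \<Rightarrow> nat) \<Rightarrow> (real \<Rightarrow> real) set" where
  "X k n = {y_gen n j i | j i. j \<in> {2..k} \<and> i < n j} \<union> {z_gen n j i | j i. j \<in> {1..k} \<and> i < n j}"

text \<open>The length is \<open>\<infinity>\<close> for elements that are not products of generators and their inverses.\<close>

definition word_length :: "('a, 'b) monoid_scheme \<Rightarrow> 'a set \<Rightarrow> 'a \<Rightarrow> enat" where
  "word_length G A x =
     (INF ws \<in> {ws. set ws \<subseteq> A \<union> m_inv G ` A \<and> foldr (mult G) ws (one G) = x}. enat (length ws))"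

end

theory Submission
  imports Defs
begin

text \<open>
  Every \<open>w\<close> has a diagram \<open>(S, T)\<close>, and with \<open>R\<close> the right \<open>n\<^sub>1\<close>-string with as many leaves,
  \<open>w = g\<^sub>T g\<^sub>S\<^sup>-\<^sup>1\<close> where \<open>g\<^sub>T\<close> is the map with diagram \<open>(R, T)\<close>. Building \<open>T\<close> caret by caret writes
  \<open>g\<^sub>T\<close> as a product of the infinitely many \<open>(y\<^sub>j)\<^sub>i\<close> and \<open>(z\<^sub>j)\<^sub>i\<close>, one for each caret. Conjugation by
  \<open>\<sigma> = (z\<^sub>1)\<^sub>0\<close> lowers the leaf number \<open>i > n\<^sub>1 - 1\<close> by \<open>n\<^sub>1 - 1\<close>, so each of these is a conjugate of a
  standard generator by a power of \<open>\<sigma>\<close>. If the carets are attached in depth-first order from right to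
  left, then the exponents for consecutive carets differ little enough for the powers of \<open>\<sigma>\<close> to
  telescope to a word of length linear in the number of leaves.
\<close>

section \<open>Piecewise affine maps between subdivided intervals\<close>

definition affine_piece :: "(real \<Rightarrow> real) \<Rightarrow> real \<times> real \<Rightarrow> real \<times> real \<Rightarrow> bool" where
  "affine_piece f p q \<longleftrightarrow>
     (\<forall>t\<in>{fst p..snd p}. f t = fst q + (snd q - fst q) / (snd p - fst p) * (t - fst p))"

fun chain :: "real \<Rightarrow> (real \<times> real) list \<Rightarrow> real \<Rightarrow> bool" where
  "chain a [] b \<longleftrightarrow> a = b"
| "chain a (p # xs) b \<longleftrightarrow> fst p = a \<and> a < snd p \<and> chain (snd p) xs b"

lemma chain_append: "chain a (xs @ ys) b \<longleftrightarrow> (\<exists>c. chain a xs c \<and> chain c ys b)"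
  by (induction xs arbitrary: a) auto

lemma chain_le: "chain a xs b \<Longrightarrow> a \<le> b"
  by (induction xs arbitrary: a) force+

lemma chain_mem: "chain a xs b \<Longrightarrow> p \<in> set xs \<Longrightarrow> a \<le> fst p \<and> fst p < snd p \<and> snd p \<le> b"
  by (induction xs arbitrary: a) (fastforce dest: chain_le)+

lemma chain_cover:
  assumes "chain a xs b" "a < b" "t \<in> {a..b}"
  shows "\<exists>p\<in>set xs. t \<in> {fst p..snd p}"
  using assms
proof (induction xs arbitrary: a)
  case (Cons p xs)
  show ?case
  proof (cases "t \<le> snd p")
    case False
    then show ?thesis using Cons by auto
  qed (use Cons.prems in auto)
qed simp

lemma affine_pieces_unique:
  assumes "chain a xs b" "a < b" "list_all2 (affine_piece f) xs ys" "list_all2 (affine_piece g) xs ys"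
    and "t \<in> {a..b}"
  shows "f t = g t"
proof -
  obtain i where "i < length xs" "t \<in> {fst (xs ! i)..snd (xs ! i)}"
    using chain_cover[OF assms(1,2,5)] by (metis in_set_conv_nth)
  then show ?thesis
    using assms(3,4) by (auto simp: list_all2_conv_all_nth affine_piece_def)
qed

lemma affine_pieces_cong:
  assumes "chain a xs b" "list_all2 (affine_piece f) xs ys" "\<And>t. t \<in> {a..b} \<Longrightarrow> f t = g t"
  shows "list_all2 (affine_piece g) xs ys"
proof -
  have "affine_piece g p q" if "p \<in> set xs" "affine_piece f p q" for p q
    using chain_mem[OF assms(1) that(1)] that(2) assms(3) by (auto simp: affine_piece_def)
  then show ?thesis using assms(2) by (auto simp: list_all2_conv_all_nth)
qed

lemma affine_piece_mem:
  assumes "affine_piece f p q" "fst p < snd p" "fst q < snd q" "t \<in> {fst p..snd p}"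
  shows "f t \<in> {fst q..snd q}"
proof -
  define u where "u = (t - fst p) / (snd p - fst p)"
  have "0 \<le> u" "u \<le> 1"
    using assms by (auto simp: u_def)
  then have "0 \<le> (snd q - fst q) * u" "(snd q - fst q) * u \<le> snd q - fst q"
    using assms(3) by (auto intro: mult_left_le)
  moreover have "f t = fst q + (snd q - fst q) * u"
    using assms by (auto simp: affine_piece_def u_def)
  ultimately show ?thesis by auto
qed

lemma affine_piece_compose:
  assumes "affine_piece f p q" "affine_piece g q r" "fst p < snd p" "fst q < snd q"
  shows "affine_piece (g \<circ> f) p r"
  unfolding affine_piece_def
proof
  fix t assume t: "t \<in> {fst p..snd p}"
  have "g (f t) = fst r + (snd r - fst r) / (snd q - fst q) * (f t - fst q)"
    using affine_piece_mem[OF assms(1,3,4) t] assms(2) by (auto simp: affine_piece_def)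
  also have "f t - fst q = (snd q - fst q) * ((t - fst p) / (snd p - fst p))"
    using assms(1) t by (auto simp: affine_piece_def)
  finally show "(g \<circ> f) t = fst r + (snd r - fst r) / (snd p - fst p) * (t - fst p)"
    using assms(4) by simp
qed

lemma affine_pieces_compose:
  assumes "chain a xs b" "chain c ys d"
    and "list_all2 (affine_piece f) xs ys" "list_all2 (affine_piece g) ys zs"
  shows "list_all2 (affine_piece (g \<circ> f)) xs zs"
proof -
  have "affine_piece (g \<circ> f) (xs ! i) (zs ! i)" if "i < length xs" for i
    using assms(3,4) that chain_mem[OF assms(1), of "xs ! i"] chain_mem[OF assms(2), of "ys ! i"]
    by (intro affine_piece_compose[where q = "ys ! i"]) (auto simp: list_all2_conv_all_nth)
  then show ?thesis using assms(3,4) by (auto simp: list_all2_conv_all_nth)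
qed

lemma affine_pieces_mem:
  assumes "chain a xs b" "a < b" "chain c ys d" "list_all2 (affine_piece f) xs ys" "t \<in> {a..b}"
  shows "f t \<in> {c..d}"
proof -
  obtain i where i: "i < length xs" "t \<in> {fst (xs ! i)..snd (xs ! i)}"
    using chain_cover[OF assms(1,2,5)] by (metis in_set_conv_nth)
  have "affine_piece f (xs ! i) (ys ! i)" "i < length ys"
    using i(1) assms(4) by (auto simp: list_all2_conv_all_nth)
  moreover from this have *: "c \<le> fst (ys ! i) \<and> fst (ys ! i) < snd (ys ! i) \<and> snd (ys ! i) \<le> d"
    using chain_mem[OF assms(3)] by simp
  moreover have "fst (xs ! i) < snd (xs ! i)"
    using chain_mem[OF assms(1)] i(1) by simp
  ultimately have "f t \<in> {fst (ys ! i)..snd (ys ! i)}"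
    using affine_piece_mem i(2) by blast
  with * show ?thesis by auto
qed

text \<open>
  The map with given pieces is written as a sum of clamped affine maps, one for each piece, which
  makes its continuity and monotonicity evident.
\<close>

fun ramps :: "(real \<times> real) list \<Rightarrow> (real \<times> real) list \<Rightarrow> real \<Rightarrow> real" where
  "ramps (p # xs) (q # ys) t =
     (snd q - fst q) * max 0 (min 1 ((t - fst p) * inverse (snd p - fst p))) + ramps xs ys t"
| "ramps _ _ t = 0"

lemma continuous_ramps: "continuous_on A (ramps xs ys)"
proof (induction xs ys "0 :: real" rule: ramps.induct)
  case (1 p xs q ys)
  have "ramps (p # xs) (q # ys) =
    (\<lambda>t. (snd q - fst q) * max 0 (min 1 ((t - fst p) * inverse (snd p - fst p))) + ramps xs ys t)"
    by auto
  then show ?case using 1 by (auto intro!: continuous_intros)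
qed auto

lemma mono_ramps:
  assumes "chain a xs b" "chain c ys d" "s \<le> t"
  shows "ramps xs ys s \<le> ramps xs ys t"
  using assms
proof (induction xs ys t arbitrary: a c rule: ramps.induct)
  case (1 p xs q ys t)
  have "(s - fst p) * inverse (snd p - fst p) \<le> (t - fst p) * inverse (snd p - fst p)"
    using 1 by (intro mult_right_mono) auto
  then have "(snd q - fst q) * max 0 (min 1 ((s - fst p) * inverse (snd p - fst p)))
    \<le> (snd q - fst q) * max 0 (min 1 ((t - fst p) * inverse (snd p - fst p)))"
    using 1 by (intro mult_left_mono max.mono min.mono) auto
  moreover have "ramps xs ys s \<le> ramps xs ys t"
    using 1 by auto
  ultimately show ?case by simp
qed auto

lemma ramps_left:
  assumes "chain a xs b" "t \<le> a"
  shows "ramps xs ys t = 0"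
  using assms
proof (induction xs ys t arbitrary: a rule: ramps.induct)
  case (1 p xs q ys t)
  have "(t - fst p) * inverse (snd p - fst p) \<le> 0"
    using 1 by (intro mult_nonpos_nonneg) auto
  moreover have "ramps xs ys t = 0" using 1 by auto
  ultimately show ?case by simp
qed auto

lemma affine_pieces_ramps:
  assumes "chain a xs b" "chain c ys d" "length xs = length ys"
  shows "list_all2 (affine_piece (\<lambda>t. c + ramps xs ys t)) xs ys"
  using assms
proof (induction xs arbitrary: a c ys)
  case (Cons p xs)
  then obtain q zs where ys: "ys = q # zs" by (cases ys) auto
  have head: "affine_piece (\<lambda>t. c + ramps (p # xs) ys t) p q"
    unfolding affine_piece_def
  proof
    fix t assume t: "t \<in> {fst p..snd p}"
    have "ramps xs zs t = 0"
      using ramps_left Cons.prems(1) t by auto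
    moreover have "0 \<le> (t - fst p) * inverse (snd p - fst p)"
      "(t - fst p) * inverse (snd p - fst p) \<le> 1"
      using t Cons.prems by (auto simp: field_simps)
    ultimately show "c + ramps (p # xs) ys t =
        fst q + (snd q - fst q) / (snd p - fst p) * (t - fst p)"
      using Cons.prems(2) by (simp add: ys divide_inverse)
  qed
  have "list_all2 (affine_piece (\<lambda>t. snd q + ramps xs zs t)) xs zs"
    using Cons.prems by (intro Cons.IH[where a = "snd p"]) (auto simp: ys)
  moreover have "snd q + ramps xs zs t = c + ramps (p # xs) ys t" if "t \<in> {snd p..b}" for t
  proof -
    have "1 \<le> (t - fst p) * inverse (snd p - fst p)"
      using that Cons.prems by (auto simp: field_simps)
    then show ?thesis using Cons.prems(2) by (simp add: ys)
  qed
  ultimately have "list_all2 (affine_piece (\<lambda>t. c + ramps (p # xs) ys t)) xs zs"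
    using Cons.prems(1) by (auto intro: affine_pieces_cong[where a = "snd p"])
  then show ?case using head by (simp add: ys)
qed simp

lemma affine_pieces_id: "chain a xs b \<Longrightarrow> list_all2 (affine_piece (\<lambda>t. t)) xs xs"
  using chain_mem by (fastforce simp: list_all2_conv_all_nth affine_piece_def)

lemma chain_subinterval:
  assumes "chain a xs b" "a \<le> u" "u < v" "v \<le> b" "{u<..<v} \<inter> fst ` set xs = {}"
  shows "\<exists>p\<in>set xs. fst p \<le> u \<and> v \<le> snd p"
  using assms
proof (induction xs arbitrary: a)
  case (Cons p xs)
  show ?case
  proof (cases "u < snd p")
    case True
    have "v \<le> snd p"
    proof (cases xs)
      case Nil
      then show ?thesis using Cons.prems by simp
    next
      case (Cons q zs)
      then have "snd p \<in> fst ` set (p # xs)" using Cons.prems(1) by auto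
      then have "snd p \<notin> {u<..<v}" using Cons.prems(5) by blast
      then show ?thesis using True by auto
    qed
    then show ?thesis using Cons.prems by auto
  next
    case False
    then show ?thesis using Cons.prems Cons.IH[of "snd p"] by auto
  qed
qed simp

section \<open>Leaf intervals\<close>

fun forest_intervals :: "tree list \<Rightarrow> real \<Rightarrow> real \<Rightarrow> (real \<times> real) list" where
  "forest_intervals [] a h = []"
| "forest_intervals (t # ts) a h = leaf_intervals t a (a + h) @ forest_intervals ts (a + h) h"

lemma forest_intervals_conv:
  "forest_intervals ts a h =
     concat (map (\<lambda>i. leaf_intervals (ts ! i) (a + real i * h) (a + real (Suc i) * h)) [0..<length ts])"
proof (induction ts arbitrary: a)
  case (Cons t ts)
  have "map (\<lambda>i. leaf_intervals ((t # ts) ! i) (a + real i * h) (a + real (Suc i) * h))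
      [0..<Suc (length ts)] =
    leaf_intervals t a (a + h) #
    map (\<lambda>i. leaf_intervals (ts ! i) (a + h + real i * h) (a + h + real (Suc i) * h)) [0..<length ts]"
    by (subst map_upt_Suc) (simp add: algebra_simps)
  then show ?case using Cons by simp
qed simp

lemma leaf_intervals_Caret:
  "leaf_intervals (Caret ts) a b = forest_intervals ts a ((b - a) / real (length ts))"
  by (simp add: forest_intervals_conv)

declare leaf_intervals.simps(2)[simp del] leaf_intervals_Caret[simp]

lemma length_leaf_intervals [simp]: "length (leaf_intervals T a b) = num_leaves T"
proof (induction T arbitrary: a b)
  case (Caret ts)
  have "length (forest_intervals ts a h) = sum_list (map num_leaves ts)" for a h
    using Caret by (induction ts arbitrary: a) auto
  then show ?case by simp
qed simp

lemma length_forest_intervals [simp]: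
  "length (forest_intervals ts a h) = sum_list (map num_leaves ts)"
  by (induction ts arbitrary: a) auto

lemma chain_leaf_intervals:
  assumes "tree_of_types N T" "0 \<notin> N" "a < b"
  shows "chain a (leaf_intervals T a b) b"
  using assms
proof (induction T arbitrary: a b)
  case (Caret ts)
  have *: "chain a (forest_intervals us a h) (a + real (length us) * h)" if "set us \<subseteq> set ts" "0 < h"
    for us a h
    using that
  proof (induction us arbitrary: a)
    case (Cons t us)
    have "chain (a + h) (forest_intervals us (a + h) h) (a + h + real (length us) * h)"
      using Cons.prems by (intro Cons.IH) auto
    moreover have "chain a (leaf_intervals t a (a + h)) (a + h)"
      using Cons.prems Caret by auto
    ultimately show ?case by (auto simp: chain_append algebra_simps)
  qed simp
  have "ts \<noteq> []" using Caret by auto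
  then have "a + real (length ts) * ((b - a) / real (length ts)) = b" "(b - a) / real (length ts) > 0"
    using Caret.prems by auto
  then show ?case using *[of ts "(b - a) / real (length ts)" a] by simp
qed simp

lemma affine_pieces_leaf_intervals:
  assumes "tree_of_types N T" "0 \<notin> N" "a < b" "affine_piece f (a, b) (c, d)"
  shows "list_all2 (affine_piece f) (leaf_intervals T a b) (leaf_intervals T c d)"
  using assms
proof (induction T arbitrary: a b c d)
  case (Caret ts)
  define l where "l = length ts"
  have "l > 0" using Caret.prems by (auto simp: l_def)
  define m where "m = (d - c) / (b - a)"
  have *: "list_all2 (affine_piece f) (forest_intervals us u h) (forest_intervals us v (m * h))"
    if "set us \<subseteq> set ts" "0 < h" "\<forall>t\<in>{u..u + real (length us) * h}. f t = v + m * (t - u)" for us u v h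
    using that
  proof (induction us arbitrary: u v)
    case (Cons t us)
    have "affine_piece f (u, u + h) (v, v + m * h)"
      unfolding affine_piece_def
    proof
      fix x assume "x \<in> {fst (u, u + h)..snd (u, u + h)}"
      moreover have "h \<le> real (length (t # us)) * h" using Cons.prems(2) by simp
      ultimately have "x \<in> {u..u + real (length (t # us)) * h}"
        by auto
      then show "f x = fst (v, v + m * h) + (snd (v, v + m * h) - fst (v, v + m * h)) /
          (snd (u, u + h) - fst (u, u + h)) * (x - fst (u, u + h))"
        using Cons.prems(2,3) by auto
    qed
    then have "list_all2 (affine_piece f) (leaf_intervals t u (u + h)) (leaf_intervals t v (v + m * h))"
      using Cons.prems Caret by auto
    moreover have "list_all2 (affine_piece f) (forest_intervals us (u + h) h)
        (forest_intervals us (v + m * h) (m * h))"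
    proof (rule Cons.IH)
      have "f t = v + m * (t - u)" if "t \<in> {u + h..u + h + real (length us) * h}" for t
        using that Cons.prems(2,3) by (auto simp: ring_distribs)
      then show "\<forall>t\<in>{u + h..u + h + real (length us) * h}. f t = v + m * h + m * (t - (u + h))"
        by (auto simp: algebra_simps)
    qed (use Cons.prems in auto)
    ultimately show ?case by (auto intro: list_all2_appendI)
  qed simp
  have "list_all2 (affine_piece f) (forest_intervals ts a ((b - a) / real l))
      (forest_intervals ts c (m * ((b - a) / real l)))"
    using Caret.prems(3,4) \<open>l > 0\<close>
    by (intro *) (auto simp: affine_piece_def m_def l_def)
  moreover have "m * ((b - a) / real l) = (d - c) / real l"
    using Caret.prems(3) by (simp add: m_def)
  ultimately show ?case by (simp only: leaf_intervals_Caret l_def)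
qed simp

section \<open>Attaching trees\<close>

lemma attach_leaf_intervals:
  fixes C :: tree
  shows "i < num_leaves T \<Longrightarrow> leaf_intervals (attach i C T) a b =
      take i (leaf_intervals T a b) @
      leaf_intervals C (fst (leaf_intervals T a b ! i)) (snd (leaf_intervals T a b ! i)) @
      drop (Suc i) (leaf_intervals T a b)"
  and "i < sum_list (map num_leaves ts) \<Longrightarrow> forest_intervals (attach_list i C ts) a h =
      take i (forest_intervals ts a h) @
      leaf_intervals C (fst (forest_intervals ts a h ! i)) (snd (forest_intervals ts a h ! i)) @
      drop (Suc i) (forest_intervals ts a h) \<and> length (attach_list i C ts) = length ts"
proof (induction i C T and i C ts arbitrary: a b and a h rule: attach_attach_list.induct)
  case (4 i c t ts)
  then show ?case by (auto simp: nth_append Suc_diff_le not_less)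
qed auto

lemma num_leaves_attach:
  "i < num_leaves T \<Longrightarrow> Suc (num_leaves (attach i C T)) = num_leaves T + num_leaves C"
  "i < sum_list (map num_leaves ts) \<Longrightarrow>
     Suc (sum_list (map num_leaves (attach_list i C ts))) = sum_list (map num_leaves ts) + num_leaves C"
  by (induction i C T and i C ts rule: attach_attach_list.induct) auto

lemma tree_of_types_attach:
  "tree_of_types N T \<Longrightarrow> tree_of_types N C \<Longrightarrow> tree_of_types N (attach i C T)"
  "\<forall>t\<in>set ts. tree_of_types N t \<Longrightarrow> tree_of_types N C \<Longrightarrow>
     length (attach_list i C ts) = length ts \<and> (\<forall>t\<in>set (attach_list i C ts). tree_of_types N t)"
  by (induction i C T and i C ts rule: attach_attach_list.induct) auto

lemma attach_attach_nested:
  "i < num_leaves T \<Longrightarrow> m < num_leaves C \<Longrightarrow> attach (i + m) E (attach i C T) = attach i (attach m E C) T"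
  "i < sum_list (map num_leaves ts) \<Longrightarrow> m < num_leaves C \<Longrightarrow>
     attach_list (i + m) E (attach_list i C ts) = attach_list i (attach m E C) ts"
proof (induction i C T and i C ts rule: attach_attach_list.induct)
  case (4 i c t ts)
  show ?case
  proof (cases "i < num_leaves t")
    case True
    then have "i + m < num_leaves (attach i c t)"
      using num_leaves_attach(1)[OF True, of c] 4(4) by linarith
    then show ?thesis using 4 True by auto
  next
    case False
    then have "i + m - num_leaves t = i - num_leaves t + m" by simp
    then show ?thesis using 4 False by auto
  qed
qed auto

lemma attach_attach_commute:
  "i < j \<Longrightarrow> j < num_leaves T \<Longrightarrow> num_leaves C \<ge> 1 \<Longrightarrow>
     attach i C (attach j E T) = attach (j + num_leaves C - 1) E (attach i C T)"
  "i < j \<Longrightarrow> j < sum_list (map num_leaves ts) \<Longrightarrow> num_leaves C \<ge> 1 \<Longrightarrow>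
     attach_list i C (attach_list j E ts) = attach_list (j + num_leaves C - 1) E (attach_list i C ts)"
proof (induction i C T and i C ts arbitrary: j and j rule: attach_attach_list.induct)
  case (4 i c t ts)
  consider "j < num_leaves t" | "i < num_leaves t" "\<not> j < num_leaves t" | "\<not> i < num_leaves t"
    by blast
  then show ?case
  proof cases
    case 1
    then show ?thesis
      using 4(1,3,4,5) num_leaves_attach(1)[of i t c] num_leaves_attach(1)[of j t E]
      by auto
  next
    case 2
    then show ?thesis
      using 4(3-5) num_leaves_attach(1)[of i t c] by auto
  next
    case 3
    then show ?thesis
      using 4(2-5) by auto
  qed
qed auto

lemma attach_Leaf: "attach i Leaf T = T" "attach_list i Leaf ts = ts"
  by (induction i Leaf T and i Leaf ts rule: attach_attach_list.induct) auto

lemma attach_list_replicate_Leaf: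
  "attach_list (m + i) C (replicate m Leaf @ ts) = replicate m Leaf @ attach_list i C ts"
  by (induction m) auto

lemma num_leaves_right_string: "num_leaves (right_string m i) = i * (m - 1) + 1"
  by (induction i) (auto simp: sum_list_replicate)

lemma attach_right_string:
  "attach (p * (m - 1)) (right_string m r) (right_string m p) = right_string m (p + r)"
proof (induction p)
  case (Suc p)
  then show ?case
    using attach_list_replicate_Leaf[of "m - 1" "p * (m - 1)" "right_string m r" "[right_string m p]"]
    by (simp add: num_leaves_right_string)
qed simp

lemma attach_caret_Leaf:
  "attach_list m u (replicate (Suc m) Leaf @ us) = replicate m Leaf @ u # us"
  using attach_list_replicate_Leaf[of m 0 u "Leaf # us"] by (simp add: replicate_app_Cons_same)

section \<open>Maps represented by tree-pair diagrams\<close>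

lemma represents_iff:
  "represents S T f \<longleftrightarrow> f \<in> extensional {0..1} \<and>
     list_all2 (affine_piece f) (leaf_intervals S 0 1) (leaf_intervals T 0 1)"
  by (auto simp: represents_def list_all2_conv_all_nth affine_piece_def case_prod_beta)

locale caret_types =
  fixes N :: "nat set"
  assumes two_le: "m \<in> N \<Longrightarrow> 2 \<le> m"
begin

abbreviation valid :: "tree \<Rightarrow> bool" where
  "valid \<equiv> tree_of_types N"

lemma zero_notin: "0 \<notin> N"
  using two_le by force

lemma chain_valid: "valid T \<Longrightarrow> chain 0 (leaf_intervals T 0 1) 1"
  using chain_leaf_intervals zero_notin by simp

lemma num_leaves_pos: "valid T \<Longrightarrow> 0 < num_leaves T"
  using chain_valid[of T] length_leaf_intervals[of T 0 1] by (cases "leaf_intervals T 0 1") auto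

lemma represents_unique:
  assumes "valid S" "represents S T f" "represents S T g"
  shows "f = g"
proof (rule extensionalityI[of f "{0..1}"])
  show "f t = g t" if "t \<in> {0..1}" for t
    using affine_pieces_unique[OF chain_valid[OF assms(1)] zero_less_one _ _ that] assms(2,3)
    unfolding represents_iff by blast
qed (use assms in \<open>auto simp: represents_iff\<close>)

lemma represents_restrict:
  assumes "valid S" "list_all2 (affine_piece f) (leaf_intervals S 0 1) (leaf_intervals T 0 1)"
  shows "represents S T (restrict f {0..1})"
  using affine_pieces_cong[OF chain_valid[OF assms(1)] assms(2), of "restrict f {0..1}"]
  by (simp add: represents_iff)

lemma represents_diagram_map:
  assumes "valid S" "valid T" "num_leaves S = num_leaves T"
  shows "represents S T (diagram_map S T)"
proof -
  have f: "represents S T (restrict (\<lambda>t. 0 + ramps (leaf_intervals S 0 1) (leaf_intervals T 0 1) t) {0..1})"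
    using assms
    by (intro represents_restrict affine_pieces_ramps[OF chain_valid chain_valid]) auto
  show ?thesis
    unfolding diagram_map_def
    by (rule theI[of "represents S T", OF f]) (erule represents_unique[OF assms(1) _ f])
qed

lemma represents_compose:
  assumes "valid S" "valid T" "represents S T f" "represents T U g"
  shows "represents S U (compose {0..1} g f)"
  using represents_restrict[OF assms(1), of "g \<circ> f" U] assms(3,4)
    affine_pieces_compose[OF chain_valid[OF assms(1)] chain_valid[OF assms(2)]]
  by (simp add: represents_iff compose_def o_def)

lemma represents_refl: "valid S \<Longrightarrow> represents S S (\<lambda>t\<in>{0..1}. t)"
  by (intro represents_restrict affine_pieces_id[OF chain_valid])

lemma represents_attach:
  assumes "valid S" "valid T" "valid C" "represents S T f" "i < num_leaves S"
  shows "represents (attach i C S) (attach i C T) f"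
proof -
  have *: "list_all2 (affine_piece f) (leaf_intervals S 0 1) (leaf_intervals T 0 1)"
    using assms(4) by (simp add: represents_iff)
  then have i: "i < num_leaves T" and
    "affine_piece f (leaf_intervals S 0 1 ! i) (leaf_intervals T 0 1 ! i)"
    using assms(5) by (auto simp: list_all2_conv_all_nth)
  moreover have "fst (leaf_intervals S 0 1 ! i) < snd (leaf_intervals S 0 1 ! i)"
    using chain_mem[OF chain_valid[OF assms(1)], of "leaf_intervals S 0 1 ! i"] assms(5) by simp
  ultimately have "list_all2 (affine_piece f)
      (leaf_intervals C (fst (leaf_intervals S 0 1 ! i)) (snd (leaf_intervals S 0 1 ! i)))
      (leaf_intervals C (fst (leaf_intervals T 0 1 ! i)) (snd (leaf_intervals T 0 1 ! i)))"
    using affine_pieces_leaf_intervals[OF assms(3) zero_notin] by simp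
  then show ?thesis
    using assms(4,5) i *
    by (auto simp: represents_iff attach_leaf_intervals list_all2_takeI list_all2_dropI
        intro!: list_all2_appendI)
qed

lemma represents_mem:
  assumes "valid S" "valid T" "represents S T f" "t \<in> {0..1}"
  shows "f t \<in> {0..1}"
  using affine_pieces_mem[OF chain_valid[OF assms(1)] _ chain_valid[OF assms(2)] _ assms(4)] assms(3)
  by (simp add: represents_iff)

lemma represents_left_inverse:
  assumes "valid S" "valid T" "represents S T f" "represents T S g" "t \<in> {0..1}"
  shows "g (f t) = t"
  using represents_unique[OF assms(1) represents_compose[OF assms(1-4)] represents_refl[OF assms(1)]]
    assms(5) by (metis compose_eq restrict_apply')

lemma represents_ramps:
  assumes "valid S" "valid T" "represents S T f" "t \<in> {0..1}"
  shows "f t = ramps (leaf_intervals S 0 1) (leaf_intervals T 0 1) t"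
proof -
  have *: "list_all2 (affine_piece f) (leaf_intervals S 0 1) (leaf_intervals T 0 1)"
    using assms(3) by (simp add: represents_iff)
  have "f t = 0 + ramps (leaf_intervals S 0 1) (leaf_intervals T 0 1) t"
    using list_all2_lengthD[OF *]
    by (intro affine_pieces_unique[OF chain_valid[OF assms(1)] zero_less_one * _ assms(4)]
        affine_pieces_ramps[OF chain_valid[OF assms(1)] chain_valid[OF assms(2)]])
  then show ?thesis by simp
qed

lemma represents_continuous:
  assumes "valid S" "valid T" "represents S T f"
  shows "continuous_on {0..1} f"
  by (rule continuous_on_eq[OF continuous_ramps]) (simp add: represents_ramps[OF assms])

lemma represents_bij_betw:
  assumes "valid S" "valid T" "represents S T f"
  shows "bij_betw f {0..1} {0..1}"
proof -
  have "num_leaves T = num_leaves S" using assms(3) by (simp add: represents_def)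
  then have "represents T S (diagram_map T S)"
    by (intro represents_diagram_map assms)
  then show ?thesis
    using represents_left_inverse represents_mem assms
    by (intro bij_betwI[where g = "diagram_map T S"]) auto
qed

lemma represents_in_Bij:
  assumes "valid S" "valid T" "represents S T f"
  shows "f \<in> Bij {0..1}"
  using assms represents_bij_betw by (auto simp: Bij_def represents_iff)

lemma represents_homeomorphism:
  assumes "valid S" "valid T" "represents S T f" "represents T S g"
  shows "homeomorphism {0..1} {0..1} f g"
  unfolding homeomorphism_def
  using assms represents_continuous represents_bij_betw represents_left_inverse
  by (simp add: bij_betw_def)

lemma represents_strict_mono:
  assumes "valid S" "valid T" "represents S T f"
  shows "strict_mono_on {0..1} f"
proof (rule strict_mono_onI)
  fix s t :: real assume st: "s \<in> {0..1}" "t \<in> {0..1}" "s < t"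
  then have "f s \<le> f t"
    using represents_ramps[OF assms] mono_ramps[OF chain_valid[OF assms(1)] chain_valid[OF assms(2)]]
    by simp
  moreover have "f s \<noteq> f t"
    using represents_bij_betw[OF assms] st unfolding bij_betw_def inj_on_def by blast
  ultimately show "f s < f t" by simp
qed

end

locale parameters =
  fixes k :: nat and n :: "nat \<Rightarrow> nat"
  assumes k: "k \<ge> 1"
    and n_ge: "\<And>j. j \<in> {1..k} \<Longrightarrow> n j \<ge> 2"
    and n_dvd: "\<And>j. j \<in> {1..k} \<Longrightarrow> n 1 - 1 dvd n j - 1"
begin

sublocale caret_types "n ` {1..k}"
  by unfold_locales (use n_ge in auto)

abbreviation "slopes \<equiv> slope_group k n"

definition base :: nat where "base = (\<Prod>j=1..k. n j)"

abbreviation "breaks \<equiv> breakpoint_ring k n"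

lemma base_pos: "base > 0"
  unfolding base_def using n_ge by (intro prod_pos) fastforce

lemma breaks_iff: "x \<in> breaks \<longleftrightarrow> (\<exists>(a :: int) e. x = of_int a / real base ^ e)"
  by (auto simp: breakpoint_ring_def base_def)

lemma breaks_add:
  assumes "x \<in> breaks" "y \<in> breaks"
  shows "x + y \<in> breaks"
proof -
  obtain a e b f where "x = of_int a / real base ^ e" "y = of_int b / real base ^ f"
    using assms by (auto simp: breaks_iff)
  then have "x + y = of_int (a * int base ^ f + b * int base ^ e) / real base ^ (e + f)"
    using base_pos by (simp add: power_add add_frac_eq)
  then show ?thesis unfolding breaks_iff by blast
qed

lemma breaks_zero: "0 \<in> breaks" and breaks_one: "1 \<in> breaks"
  unfolding breaks_iff by (rule exI[of _ 0] exI[of _ 1], rule exI[of _ 0], simp)+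

lemma breaks_divide:
  assumes "x \<in> breaks" "m \<in> n ` {1..k}"
  shows "x / real m \<in> breaks"
proof -
  obtain a e where x: "x = of_int a / real base ^ e"
    using assms by (auto simp: breaks_iff)
  have "m dvd base"
    using assms(2) by (auto simp: base_def intro: dvd_prodI)
  then obtain c where c: "base = m * c" by (auto simp: dvd_def)
  then have "x / real m = of_int (a * int c) / real base ^ Suc e"
    using base_pos by (simp add: x field_simps)
  then show ?thesis unfolding breaks_iff by blast
qed

lemma slopesI: "(\<Prod>j=1..k. real (n j) powi e j) \<in> slopes"
  by (auto simp: slope_group_def)

lemma slopes_mult:
  assumes "x \<in> slopes" "y \<in> slopes"
  shows "x * y \<in> slopes"
proof -
  obtain e f where "x = (\<Prod>j=1..k. real (n j) powi e j)" "y = (\<Prod>j=1..k. real (n j) powi f j)"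
    using assms by (auto simp: slope_group_def)
  moreover have "real (n j) powi (e j) * real (n j) powi (f j) = real (n j) powi (e j + f j)"
    if "j \<in> {1..k}" for j
    using n_ge[OF that] by (subst power_int_add) auto
  ultimately have "x * y = (\<Prod>j=1..k. real (n j) powi (e j + f j))"
    by (simp flip: prod.distrib)
  then show ?thesis using slopesI by metis
qed

lemma slopes_inverse:
  assumes "x \<in> slopes"
  shows "inverse x \<in> slopes"
proof -
  obtain e where "x = (\<Prod>j=1..k. real (n j) powi e j)"
    using assms by (auto simp: slope_group_def)
  then have "inverse x = (\<Prod>j=1..k. real (n j) powi (- e j))"
    by (simp add: power_int_minus flip: prod_inversef)
  then show ?thesis using slopesI by metis
qed

lemma slopes_one: "1 \<in> slopes"
  using slopesI[of "\<lambda>_. 0"] by simp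

lemma slopes_type:
  assumes "m \<in> n ` {1..k}"
  shows "real m \<in> slopes"
proof -
  obtain i where i: "i \<in> {1..k}" "m = n i" using assms by auto
  have "(\<Prod>j=1..k. real (n j) powi (if j = i then 1 else 0)) = (\<Prod>j=1..k. if j = i then real (n i) else 1)"
    by (intro prod.cong) auto
  also have "\<dots> = real m" using i by simp
  finally show ?thesis using slopesI by metis
qed

lemma leaf_intervals_breaks_slopes:
  assumes "valid T" "a \<in> breaks" "b - a \<in> breaks" "b - a \<in> slopes" "p \<in> set (leaf_intervals T a b)"
  shows "fst p \<in> breaks" "snd p - fst p \<in> slopes"
proof -
  have "fst p \<in> breaks \<and> snd p - fst p \<in> slopes"
    using assms
  proof (induction T arbitrary: a b)
    case (Caret ts)
    have *: "fst p \<in> breaks \<and> snd p - fst p \<in> slopes"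
      if "set us \<subseteq> set ts" "a \<in> breaks" "h \<in> breaks" "h \<in> slopes" "p \<in> set (forest_intervals us a h)"
      for us a h
      using that
    proof (induction us arbitrary: a)
      case (Cons u us)
      then consider "p \<in> set (leaf_intervals u a (a + h))" | "p \<in> set (forest_intervals us (a + h) h)"
        by auto
      then show ?case
      proof cases
        case 1
        then show ?thesis using Caret.IH[of u a "a + h"] Caret.prems(1) Cons.prems by simp
      next
        case 2
        then show ?thesis using Cons.IH[of "a + h"] Cons.prems by (simp add: breaks_add)
      qed
    qed simp
    have "length ts \<in> n ` {1..k}" using Caret.prems by simp
    then have "(b - a) / real (length ts) \<in> breaks" "(b - a) / real (length ts) \<in> slopes"
      using Caret.prems(3,4) breaks_divide slopes_mult slopes_inverse slopes_type
      by (auto simp: divide_inverse)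
    then show ?case using *[of ts a] Caret.prems(2,5) by simp
  qed simp
  then show "fst p \<in> breaks" "snd p - fst p \<in> slopes" by auto
qed

lemma represents_in_F_carrier:
  assumes "valid S" "valid T" "represents S T f"
  shows "f \<in> F_carrier k n"
proof -
  let ?xs = "leaf_intervals S 0 1" and ?ys = "leaf_intervals T 0 1"
  have *: "fst p \<in> breaks \<and> snd p - fst p \<in> slopes" if "valid U" "p \<in> set (leaf_intervals U 0 1)" for U p
    using leaf_intervals_breaks_slopes[OF that(1) _ _ _ that(2)] breaks_zero breaks_one slopes_one by simp
  have "\<exists>m\<in>slopes. \<forall>t\<in>{u..v}. f t = f u + m * (t - u)"
    if uv: "0 \<le> u" "u < v" "v \<le> 1" "{u<..<v} \<inter> fst ` set ?xs = {}" for u v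
  proof -
    obtain i where i: "i < length ?xs" "fst (?xs ! i) \<le> u" "v \<le> snd (?xs ! i)"
      using chain_subinterval[OF chain_valid[OF assms(1)] uv] by (metis in_set_conv_nth)
    have i': "i < length ?ys" "affine_piece f (?xs ! i) (?ys ! i)"
      using assms(3) i(1) by (auto simp: represents_iff list_all2_conv_all_nth)
    define m where "m = (snd (?ys ! i) - fst (?ys ! i)) / (snd (?xs ! i) - fst (?xs ! i))"
    have "m \<in> slopes"
      unfolding m_def divide_inverse
      using *[OF assms(1) nth_mem[OF i(1)]] *[OF assms(2) nth_mem[OF i'(1)]]
      by (simp add: slopes_mult slopes_inverse)
    moreover have "f t = f u + m * (t - u)" if "t \<in> {u..v}" for t
    proof -
      have "f t = fst (?ys ! i) + m * (t - fst (?xs ! i))" "f u = fst (?ys ! i) + m * (u - fst (?xs ! i))"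
        using i'(2) that i uv(2) unfolding affine_piece_def m_def by auto
      then show ?thesis by (simp add: algebra_simps)
    qed
    ultimately show ?thesis by blast
  qed
  then have "piecewise_linear_with breaks slopes f"
    unfolding piecewise_linear_with_def using *[OF assms(1)]
    by (intro exI[of _ "fst ` set ?xs"]) auto
  moreover have "represents T S (diagram_map T S)"
    using assms by (intro represents_diagram_map) (auto simp: represents_def)
  ultimately show ?thesis
    unfolding F_carrier_def
    using represents_in_Bij represents_strict_mono represents_homeomorphism assms by blast
qed

end

section \<open>Every element has a diagram\<close>

definition grid :: "real \<Rightarrow> real \<Rightarrow> nat \<Rightarrow> (real \<times> real) list" where
  "grid a h m = map (\<lambda>i. (a + real i * h, a + real (Suc i) * h)) [0..<m]"

lemma length_grid [simp]: "length (grid a h m) = m"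
  by (simp add: grid_def)

lemma grid_add: "grid a h (l + m) = grid a h l @ grid (a + real l * h) h m"
  by (rule nth_equalityI) (auto simp: grid_def nth_append algebra_simps of_nat_diff)

lemma grid_Suc: "grid a h (Suc m) = (a, a + h) # grid (a + h) h m"
  using grid_add[of a h 1 m] by (simp add: grid_def)

definition uniform :: "nat \<Rightarrow> tree \<Rightarrow> bool" where
  "uniform m U \<longleftrightarrow> (\<forall>a b. leaf_intervals U a b = grid a ((b - a) / real m) m)"

lemma uniform_Caret:
  assumes "uniform m U" "0 < m" "0 < l"
  shows "uniform (l * m) (Caret (replicate l U))"
proof -
  have "forest_intervals (replicate i U) a h = grid a (h / real m) (i * m)" for i a h
  proof (induction i arbitrary: a)
    case (Suc i)
    have "leaf_intervals U a (a + h) = grid a (h / real m) m"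
      using assms(1) by (simp add: uniform_def)
    then show ?case using Suc assms(2) grid_add[of a "h / real m" m "i * m"] by simp
  qed (simp add: grid_def)
  then show ?thesis
    using assms(3) by (simp add: uniform_def)
qed

context parameters
begin

lemma uniform_tree_exists: "\<exists>U. valid U \<and> uniform (\<Prod>j=1..k. n j ^ e j) U"
proof -
  have power: "\<exists>U. valid U \<and> uniform (n j ^ r * m) U"
    if "\<exists>U. valid U \<and> uniform m U" "j \<in> {1..k}" "0 < m" for j r m
  proof (induction r)
    case (Suc r)
    then obtain U where "valid U" "uniform (n j ^ r * m) U" by blast
    then have "valid (Caret (replicate (n j) U)) \<and> uniform (n j * (n j ^ r * m)) (Caret (replicate (n j) U))"
      using uniform_Caret[of "n j ^ r * m" U "n j"] that(2,3) n_ge[OF that(2)] by auto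
    then show ?case by (metis mult.assoc power_Suc)
  qed (use that in simp)
  have "\<exists>U. valid U \<and> uniform (\<Prod>j\<in>J. n j ^ e j) U" if "finite J" "J \<subseteq> {1..k}" for J
    using that
  proof (induction J rule: finite_induct)
    case empty
    have "valid Leaf \<and> uniform 1 Leaf" by (simp add: uniform_def grid_def)
    then show ?case by (metis prod.empty)
  next
    case (insert i J)
    have "0 < n j ^ e j" if "j \<in> J" for j
      using n_ge[of j] that insert by auto
    then show ?case
      using insert power[of "\<Prod>j\<in>J. n j ^ e j" i "e i"] by (simp add: prod_pos)
  qed
  then show ?thesis by blast
qed

lemma uniform_tree_base_power: "\<exists>U. valid U \<and> uniform (base ^ m) U"
  using uniform_tree_exists[of "\<lambda>_. m"] by (simp add: base_def prod_power_distrib)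

text \<open>
  The domain tree is obtained from a uniform tree whose leaf intervals contain no breakpoints of
  \<open>f\<close> by subdividing each of them uniformly into as many parts as needed for all images to have
  the same length; the range tree is then uniform as well.
\<close>

lemma diagram_exists:
  assumes "f \<in> F_carrier k n"
  shows "\<exists>S T. valid S \<and> valid T \<and> represents S T f"
proof -
  have bij: "f \<in> Bij {0..1}" and mono: "strict_mono_on {0..1} f"
    using assms by (auto simp: F_carrier_def)
  have f_mem: "f t \<in> {0..1}" if "t \<in> {0..1}" for t
    using bij that by (auto simp: Bij_def bij_betw_def)
  have f_surj: "\<exists>t\<in>{0..1}. f t = y" if "y \<in> {0..1}" for y
  proof -
    have "f ` {0..1} = {0..1}" using bij by (simp add: Bij_def bij_betw_def)
    then show ?thesis using that by (metis imageE)
  qed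
  have "f 0 = 0"
  proof -
    obtain t where "t \<in> {0..1}" "f t = 0" using f_surj[of 0] by auto
    then show ?thesis
      using f_mem[of 0] strict_mono_onD[OF mono, of 0 t] by (cases "t = 0") auto
  qed
  have "f 1 = 1"
  proof -
    obtain t where "t \<in> {0..1}" "f t = 1" using f_surj[of 1] by auto
    then show ?thesis
      using f_mem[of 1] strict_mono_onD[OF mono, of t 1] by (cases "t = 1") auto
  qed
  have "piecewise_linear_with breaks slopes f"
    using assms by (simp add: F_carrier_def)
  then obtain A where A: "finite A" "A \<subseteq> breaks"
    and pieces: "\<And>a b. 0 \<le> a \<Longrightarrow> a < b \<Longrightarrow> b \<le> 1 \<Longrightarrow> {a<..<b} \<inter> A = {} \<Longrightarrow>
      \<exists>s\<in>slopes. \<forall>t\<in>{a..b}. f t = f a + s * (t - a)"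
    unfolding piecewise_linear_with_def by metis
  have "\<forall>\<^sub>F m in sequentially. x * real base ^ m \<in> \<int>" if "x \<in> breaks" for x
  proof -
    obtain a e where x: "x = of_int a / real base ^ e" using \<open>x \<in> breaks\<close> unfolding breaks_iff by blast
    have "x * real base ^ m = of_int (a * int base ^ (m - e))" if "e \<le> m" for m
    proof -
      have "real base ^ m = real base ^ (m - e) * real base ^ e"
        using that by (simp flip: power_add)
      then show ?thesis using base_pos by (simp add: x)
    qed
    then show ?thesis unfolding eventually_sequentially by (metis Ints_of_int)
  qed
  then have "\<forall>\<^sub>F m in sequentially. \<forall>x\<in>A. x * real base ^ m \<in> \<int>"
    using A by (intro eventually_ball_finite) auto
  then obtain m where m: "\<And>x. x \<in> A \<Longrightarrow> x * real base ^ m \<in> \<int>"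
    by (auto simp: eventually_sequentially)
  define M where "M = base ^ m"
  have "0 < M" using base_pos by (simp add: M_def)
  have "\<exists>e. \<forall>t\<in>{real j / real M..real (Suc j) / real M}.
      f t = f (real j / real M) + (\<Prod>i=1..k. real (n i) powi e i) * (t - real j / real M)"
    if "j < M" for j
  proof -
    have "x \<notin> {real j / real M<..<real (Suc j) / real M}" if x: "x \<in> A" for x
    proof
      assume "x \<in> {real j / real M<..<real (Suc j) / real M}"
      then have "real j < x * real M" "x * real M < real (Suc j)"
        using \<open>0 < M\<close> by (auto simp: field_simps)
      moreover obtain z where "x * real M = of_int z" using m[OF x] by (auto simp: M_def Ints_def)
      ultimately have "real_of_int (int j) < of_int z" "real_of_int z < of_int (int j + 1)" by simp_all
      then show False unfolding of_int_less_iff by simp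
    qed
    then have "\<exists>s\<in>slopes. \<forall>t\<in>{real j / real M..real (Suc j) / real M}.
        f t = f (real j / real M) + s * (t - real j / real M)"
      using \<open>j < M\<close> by (intro pieces) (auto simp: divide_simps)
    then show ?thesis unfolding slope_group_def by blast
  qed
  then obtain e where e: "\<And>j t. j < M \<Longrightarrow> t \<in> {real j / real M..real (Suc j) / real M} \<Longrightarrow>
      f t = f (real j / real M) + (\<Prod>i=1..k. real (n i) powi e j i) * (t - real j / real M)"
    by metis
  have "\<forall>\<^sub>F d in sequentially. \<forall>j\<in>{..<M}. \<forall>i\<in>{1..k}. - e j i \<le> int d"
  proof (intro eventually_ball_finite ballI)
    show "\<forall>\<^sub>F d in sequentially. - e j i \<le> int d" for i j
      unfolding eventually_sequentially by (rule exI[of _ "nat (- e j i)"]) auto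
  qed auto
  then obtain d where "\<forall>j\<in>{..<M}. \<forall>i\<in>{1..k}. - e j i \<le> int d"
    using eventually_happens' sequentially_bot by blast
  then have d: "\<And>i j. j < M \<Longrightarrow> i \<in> {1..k} \<Longrightarrow> - e j i \<le> int d"
    by simp
  define P where "P j = (\<Prod>i=1..k. n i ^ nat (int d + e j i))" for j
  have P_pos: "0 < P j" for j
    unfolding P_def using n_ge by (intro prod_pos) fastforce
  have P: "real (P j) = real base ^ d * (\<Prod>i=1..k. real (n i) powi e j i)" if "j < M" for j
  proof -
    have "real (P j) = (\<Prod>i=1..k. real (n i) powi (int d + e j i))"
      unfolding P_def of_nat_prod
    proof (intro prod.cong refl)
      show "real (n i ^ nat (int d + e j i)) = real (n i) powi (int d + e j i)" if "i \<in> {1..k}" for i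
        using d[OF \<open>j < M\<close> that] by (simp add: power_int_def)
    qed
    also have "\<dots> = (\<Prod>i=1..k. real (n i) ^ d * real (n i) powi e j i)"
    proof (intro prod.cong refl)
      show "real (n i) powi (int d + e j i) = real (n i) ^ d * real (n i) powi e j i" if "i \<in> {1..k}" for i
        using n_ge[OF that] by (subst power_int_add) auto
    qed
    finally show ?thesis by (simp add: base_def prod.distrib prod_power_distrib)
  qed
  define E where "E = M * base ^ d"
  have "0 < E" using \<open>0 < M\<close> base_pos by (simp add: E_def)
  have step: "\<exists>S xs Q. valid S \<and> leaf_intervals S 0 1 = xs @ grid (real j / real M) (1 / real M) (M - j) \<and>
      f (real j / real M) = real Q / real E \<and> list_all2 (affine_piece f) xs (grid 0 (1 / real E) Q)"
    if "j \<le> M" for j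
    using that
  proof (induction j)
    case 0
    obtain U where "valid U" "uniform M U" using uniform_tree_base_power M_def by blast
    then show ?case
      by (intro exI[of _ U] exI[of _ "[]"] exI[of _ 0]) (simp add: uniform_def \<open>f 0 = 0\<close> grid_def)
  next
    case (Suc j)
    then have "j \<le> M" by simp
    from Suc.IH[OF this] obtain S xs Q where IH: "valid S"
        "leaf_intervals S 0 1 = xs @ grid (real j / real M) (1 / real M) (M - j)"
        "f (real j / real M) = real Q / real E" "list_all2 (affine_piece f) xs (grid 0 (1 / real E) Q)"
      by blast
    obtain U where U: "valid U" "uniform (P j) U" 
      using uniform_tree_exists[of "\<lambda>i. nat (int d + e j i)"] unfolding P_def by blast
    let ?a = "real j / real M" and ?b = "real (Suc j) / real M"
    have b: "?a + 1 / real M = ?b" by (simp add: add_divide_distrib)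
    have "grid ?a (1 / real M) (M - j) = (?a, ?b) # grid ?b (1 / real M) (M - Suc j)"
      using grid_Suc[of ?a "1 / real M" "M - Suc j"] Suc.prems unfolding b by (simp add: Suc_diff_Suc)
    then have S: "leaf_intervals S 0 1 = xs @ (?a, ?b) # grid ?b (1 / real M) (M - Suc j)"
      using IH(2) by simp
    have "length xs < num_leaves S"
      using arg_cong[OF S, of length] by simp
    then have S': "leaf_intervals (attach (length xs) U S) 0 1 =
        (xs @ leaf_intervals U ?a ?b) @ grid ?b (1 / real M) (M - Suc j)"
      by (simp add: attach_leaf_intervals S)
    have "?a < ?b" using \<open>0 < M\<close> by (simp add: divide_strict_right_mono)
    have slope: "f t = f ?a + real (P j) / real base ^ d * (t - ?a)" if "t \<in> {?a..?b}" for t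
      using e[OF _ that] P[of j] Suc.prems base_pos by simp
    have diff: "f ?b - f ?a = real (P j) / real base ^ d * (?b - ?a)"
      using slope[of ?b] \<open>?a < ?b\<close> by simp
    have fb: "f ?b - f ?a = real (P j) / real E"
    proof -
      have "?b - ?a = 1 / real M" using b by linarith
      then have "f ?b - f ?a = real (P j) / real base ^ d * (1 / real M)" using diff by metis
      then show ?thesis by (simp add: E_def mult.commute)
    qed
    have "affine_piece f (?a, ?b) (f ?a, f ?b)"
      unfolding affine_piece_def
    proof
      fix t assume "t \<in> {fst (?a, ?b)..snd (?a, ?b)}"
      then have "f t = f ?a + real (P j) / real base ^ d * (t - ?a)" by (intro slope) simp
      moreover have "(f ?b - f ?a) / (?b - ?a) = real (P j) / real base ^ d"
        using diff \<open>?a < ?b\<close> by (subst nonzero_divide_eq_eq) linarith+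
      ultimately show "f t = fst (f ?a, f ?b) + (snd (f ?a, f ?b) - fst (f ?a, f ?b)) /
          (snd (?a, ?b) - fst (?a, ?b)) * (t - fst (?a, ?b))"
        by simp
    qed
    then have "list_all2 (affine_piece f) (leaf_intervals U ?a ?b) (leaf_intervals U (f ?a) (f ?b))"
      using affine_pieces_leaf_intervals[OF U(1) zero_notin \<open>?a < ?b\<close>] by blast
    moreover have "leaf_intervals U (f ?a) (f ?b) = grid (0 + real Q * (1 / real E)) (1 / real E) (P j)"
      using U(2) P_pos[of j] IH(3) fb by (simp add: uniform_def)
    ultimately have "list_all2 (affine_piece f) (xs @ leaf_intervals U ?a ?b) (grid 0 (1 / real E) (Q + P j))"
      using IH(4) by (simp only: grid_add list_all2_appendI)
    moreover have "f ?b = real (Q + P j) / real E"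
      using fb IH(3) by (simp add: add_divide_distrib)
    moreover have "valid (attach (length xs) U S)"
      using IH(1) U(1) tree_of_types_attach by blast
    ultimately show ?case using S' by blast
  qed
  obtain S xs Q where S: "valid S" "leaf_intervals S 0 1 = xs" "real Q / real E = 1"
      "list_all2 (affine_piece f) xs (grid 0 (1 / real E) Q)"
    using step[of M] \<open>0 < M\<close> \<open>f 1 = 1\<close> by (auto simp: grid_def)
  then have "real Q = real E" using \<open>0 < E\<close> by simp
  then have "Q = base ^ (m + d)"
    unfolding of_nat_eq_iff by (simp add: E_def M_def power_add)
  then obtain T where "valid T" "uniform Q T" using uniform_tree_base_power by blast
  moreover have "f \<in> extensional {0..1}" using bij by (simp add: Bij_def)
  ultimately have "represents S T f"
    using S(2,4) \<open>real Q = real E\<close> by (simp add: represents_iff uniform_def)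
  then show ?thesis using S(1) \<open>valid T\<close> by blast
qed

end

section \<open>Word length\<close>

context group
begin

definition word_ball :: "'a set \<Rightarrow> nat \<Rightarrow> 'a set" where
  "word_ball A m =
     {foldr (\<otimes>) ws \<one> | ws. set ws \<subseteq> A \<union> m_inv G ` A \<and> length ws \<le> m}"

lemma foldr_mult_closed: "set ws \<subseteq> carrier G \<Longrightarrow> foldr (\<otimes>) ws \<one> \<in> carrier G"
  by (induction ws) auto

lemma foldr_mult_append:
  "set vs \<subseteq> carrier G \<Longrightarrow> set ws \<subseteq> carrier G \<Longrightarrow>
     foldr (\<otimes>) (vs @ ws) \<one> = foldr (\<otimes>) vs \<one> \<otimes> foldr (\<otimes>) ws \<one>"
  by (induction vs) (auto simp: m_assoc foldr_mult_closed simp del: foldr_append)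

lemma word_ball_mono: "l \<le> m \<Longrightarrow> word_ball A l \<subseteq> word_ball A m"
  unfolding word_ball_def using le_trans by blast

lemma one_in_word_ball: "\<one> \<in> word_ball A m"
  unfolding word_ball_def by (auto intro: exI[of _ "[]"])

lemma generator_in_word_ball:
  assumes "A \<subseteq> carrier G" "a \<in> A"
  shows "a \<in> word_ball A 1" "inv a \<in> word_ball A 1"
proof -
  have "a \<in> carrier G" using assms by auto
  then have "foldr (\<otimes>) [a] \<one> = a" "foldr (\<otimes>) [inv a] \<one> = inv a" by simp_all
  then show "a \<in> word_ball A 1" "inv a \<in> word_ball A 1"
    unfolding word_ball_def using assms(2)
    by (intro CollectI exI[of _ "[a]"] exI[of _ "[inv a]"]; simp)+
qed

lemma word_ball_mult:
  assumes "A \<subseteq> carrier G" "x \<in> word_ball A l" "y \<in> word_ball A m"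
  shows "x \<otimes> y \<in> word_ball A (l + m)"
proof -
  obtain vs ws where "set vs \<subseteq> A \<union> m_inv G ` A" "length vs \<le> l" "x = foldr (\<otimes>) vs \<one>"
    and "set ws \<subseteq> A \<union> m_inv G ` A" "length ws \<le> m" "y = foldr (\<otimes>) ws \<one>"
    using assms(2,3) by (auto simp: word_ball_def)
  moreover from this have "set vs \<subseteq> carrier G" "set ws \<subseteq> carrier G"
    using assms(1) by auto
  ultimately show ?thesis
    unfolding word_ball_def using foldr_mult_append[of vs ws]
    by (intro CollectI exI[of _ "vs @ ws"]) (simp del: foldr_append)
qed

lemma word_ball_inv:
  assumes "A \<subseteq> carrier G" "x \<in> word_ball A m"
  shows "inv x \<in> word_ball A m"
proof -
  have "inv (foldr (\<otimes>) ws \<one>) \<in> word_ball A (length ws)" if "set ws \<subseteq> A \<union> m_inv G ` A" for ws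
    using that
  proof (induction ws)
    case (Cons a ws)
    have closed: "A \<union> m_inv G ` A \<subseteq> carrier G" using assms(1) by auto
    have "a \<in> carrier G" "foldr (\<otimes>) ws \<one> \<in> carrier G"
      using Cons.prems closed by (auto intro!: foldr_mult_closed)
    then have "inv (foldr (\<otimes>) (a # ws) \<one>) = inv (foldr (\<otimes>) ws \<one>) \<otimes> inv a"
      by (simp add: inv_mult_group)
    moreover have "inv a \<in> word_ball A 1"
      using Cons.prems generator_in_word_ball[OF assms(1)] assms(1) by (auto simp: subset_iff)
    ultimately show ?case using word_ball_mult[OF assms(1) Cons.IH, of "inv a" 1] Cons.prems by simp
  qed (simp add: one_in_word_ball)
  moreover obtain ws where "set ws \<subseteq> A \<union> m_inv G ` A" "length ws \<le> m" "x = foldr (\<otimes>) ws \<one>"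
    using assms(2) by (auto simp: word_ball_def)
  ultimately show ?thesis using word_ball_mono by blast
qed

definition conjugate :: "'a \<Rightarrow> 'a \<Rightarrow> 'a" where
  "conjugate s x = s \<otimes> x \<otimes> inv s"

lemma conjugate_closed: "s \<in> carrier G \<Longrightarrow> x \<in> carrier G \<Longrightarrow> (conjugate s ^^ r) x \<in> carrier G"
  by (induction r) (auto simp: conjugate_def)

lemma conjugate_one: "s \<in> carrier G \<Longrightarrow> (conjugate s ^^ r) \<one> = \<one>"
  by (induction r) (auto simp: conjugate_def)

lemma conjugate_mult:
  assumes "s \<in> carrier G" "x \<in> carrier G" "y \<in> carrier G"
  shows "(conjugate s ^^ r) (x \<otimes> y) = (conjugate s ^^ r) x \<otimes> (conjugate s ^^ r) y"
proof (induction r)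
  case (Suc r)
  have "conjugate s (u \<otimes> v) = conjugate s u \<otimes> conjugate s v" if "u \<in> carrier G" "v \<in> carrier G" for u v
    using assms(1) that by (simp add: conjugate_def m_assoc inv_solve_left)
  then show ?case using Suc conjugate_closed assms by simp
qed simp

lemma word_ball_unconjugate:
  assumes "A \<subseteq> carrier G" "s \<in> A" "x \<in> carrier G" "(conjugate s ^^ r) x \<in> word_ball A m"
  shows "x \<in> word_ball A (m + 2 * r)"
  using assms(3,4)
proof (induction r arbitrary: x)
  case (Suc r)
  have s: "s \<in> carrier G" using assms by auto
  have "conjugate s x \<in> word_ball A (m + 2 * r)"
    using Suc.IH[of "conjugate s x"] Suc.prems conjugate_closed[OF s, of x 1]
    by (simp add: funpow_swap1)
  then have "inv s \<otimes> conjugate s x \<otimes> s \<in> word_ball A (1 + (m + 2 * r) + 1)"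
    by (intro word_ball_mult generator_in_word_ball assms)
  moreover have "inv s \<otimes> conjugate s x \<otimes> s = x"
    using s Suc.prems(1) m_assoc[of "inv s" s x] by (simp add: conjugate_def m_assoc)
  ultimately show ?case by simp
qed simp

end

section \<open>Building trees from carets\<close>

context parameters
begin

declare One_nat_def [simp del]

abbreviation "H \<equiv> BijGroup {0..1 :: real}"

sublocale H: group H
  by (rule group_BijGroup)

abbreviation "string \<equiv> right_string (n 1)"

abbreviation "from_string \<equiv> with_right_string_domain (n 1)"

definition s :: nat where "s = n 1 - 1"

lemma one_in: "1 \<in> {1..k}"
  using k by simp

lemma s_pos: "0 < s"
  using n_ge[OF one_in] by (simp add: s_def)

lemma s_less: "j \<in> {1..k} \<Longrightarrow> s < n j"
  using n_ge[of j] n_dvd[of j] dvd_imp_le[of "n 1 - 1" "n j - 1"] by (simp add: s_def)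

lemma num_leaves_string: "num_leaves (string p) = p * s + 1"
  by (simp add: num_leaves_right_string s_def)

lemma attach_string: "attach (p * s) (string r) (string p) = string (p + r)"
  using attach_right_string by (simp add: s_def)

lemma valid_string: "valid (string p)"
  using n_ge[OF one_in] one_in by (induction p) auto

lemma valid_caret: "j \<in> {1..k} \<Longrightarrow> valid (caret (n j))"
  by (auto simp: caret_def)

lemma caret_eq_string: "caret (n 1) = string 1"
  using n_ge[OF one_in] by (cases "n 1") (auto simp: caret_def replicate_append_same[symmetric] One_nat_def)

lemma num_leaves_valid:
  assumes "valid T"
  shows "\<exists>p. num_leaves T = p * s + 1"
  using assms
proof (induction T)
  case (Caret ts)
  have *: "\<exists>p. sum_list (map num_leaves us) = p * s + length us" if "set us \<subseteq> set ts" for us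
    using that
  proof (induction us)
    case (Cons u us)
    then have "\<exists>q. sum_list (map num_leaves us) = q * s + length us" by simp
    moreover have "\<exists>p. num_leaves u = p * s + 1"
      using Cons.prems Caret by simp
    ultimately obtain p q where "num_leaves u = p * s + 1" "sum_list (map num_leaves us) = q * s + length us"
      by blast
    then have "sum_list (map num_leaves (u # us)) = (p + q) * s + length (u # us)"
      by (simp add: add_mult_distrib)
    then show ?case by blast
  qed simp
  obtain j where j: "j \<in> {1..k}" "length ts = n j" using Caret.prems by auto
  obtain c where "n j - 1 = s * c" using n_dvd[OF j(1)] by (auto simp: s_def)
  then have "length ts = c * s + 1" using j n_ge[OF j(1)] by (simp add: mult.commute)
  moreover obtain p where "sum_list (map num_leaves ts) = p * s + length ts" using * by blast
  ultimately have "num_leaves (Caret ts) = (p + c) * s + 1" by (simp add: add_mult_distrib)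
  then show ?case by blast
qed (auto intro: exI[of _ 0])

lemma represents_from_string:
  assumes "valid T" "num_leaves T = p * s + 1"
  shows "represents (string p) T (from_string T)"
proof -
  have "from_string T = diagram_map (string p) T"
    using assms(2) s_pos by (simp add: with_right_string_domain_def s_def[symmetric])
  then show ?thesis
    using assms by (auto intro!: represents_diagram_map valid_string simp: num_leaves_string)
qed

lemma from_string_eqI:
  assumes "valid T" "represents (string p) T f"
  shows "from_string T = f"
proof -
  have "num_leaves T = p * s + 1"
    using assms(2) by (simp add: represents_def num_leaves_string)
  then show ?thesis
    using represents_unique[OF valid_string represents_from_string[OF assms(1)] assms(2)] by blast
qed

lemma from_string_closed: "valid T \<Longrightarrow> from_string T \<in> carrier H"
  using num_leaves_valid represents_from_string represents_in_Bij valid_string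
  by (fastforce simp: BijGroup_def)

lemma mult_H: "x \<in> Bij {0..1} \<Longrightarrow> y \<in> Bij {0..1} \<Longrightarrow> x \<otimes>\<^bsub>H\<^esub> y = compose {0..1} x y"
  by (simp add: BijGroup_def)

lemma represents_mult:
  assumes "valid S" "valid T" "valid U" "represents S T f" "represents T U g"
  shows "represents S U (g \<otimes>\<^bsub>H\<^esub> f)"
  using assms represents_compose represents_in_Bij by (simp add: mult_H)

lemma from_string_string: "from_string (string p) = \<one>\<^bsub>H\<^esub>"
  using from_string_eqI[OF valid_string represents_refl[OF valid_string]] by (simp add: BijGroup_def)

lemma from_string_attach:
  assumes "valid T" "valid C" "num_leaves T = p * s + 1" "i \<le> p * s"
  shows "from_string (attach i C T) = from_string T \<otimes>\<^bsub>H\<^esub> from_string (attach i C (string p))"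
proof -
  have v: "valid (attach i C T)" "valid (attach i C (string p))"
    using assms valid_string tree_of_types_attach(1) by blast+
  obtain r where r: "num_leaves (attach i C (string p)) = r * s + 1"
    using num_leaves_valid[OF v(2)] by blast
  have "represents (string p) T (from_string T)"
    by (rule represents_from_string) fact+
  then have "represents (attach i C (string p)) (attach i C T) (from_string T)"
    using assms by (intro represents_attach valid_string) (auto simp: num_leaves_string)
  then show ?thesis
    using represents_mult[OF valid_string v(2,1) represents_from_string[OF v(2) r]]
    by (intro from_string_eqI v)
qed

lemma num_leaves_attach_string:
  assumes "i \<le> p * s" "num_leaves C = c * s + 1"
  shows "num_leaves (attach i C (string p)) = (p + c) * s + 1"
  using num_leaves_attach(1)[of i "string p" C] assms
  by (simp add: num_leaves_string add_mult_distrib)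

lemma from_string_stable:
  assumes "valid C" "i < p * s" "p \<le> q"
  shows "from_string (attach i C (string q)) = from_string (attach i C (string p))"
proof -
  obtain r where q: "q = p + r" using assms(3) by (auto simp: le_iff_add)
  obtain c where c: "num_leaves C = c * s + 1" using num_leaves_valid[OF assms(1)] by blast
  have v: "valid (attach i C (string t))" for t
    using assms valid_string tree_of_types_attach(1) by blast
  have "attach i C (string q) = attach i C (attach (p * s) (string r) (string p))"
    by (simp add: q attach_string)
  also have "\<dots> = attach (p * s + num_leaves C - 1) (string r) (attach i C (string p))"
    using assms(2) c by (intro attach_attach_commute) (auto simp: num_leaves_string)
  also have "p * s + num_leaves C - 1 = (p + c) * s" using c by (simp add: add_mult_distrib)
  finally have eq: "attach i C (string q) = attach ((p + c) * s) (string r) (attach i C (string p))" .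
  have l: "num_leaves (attach i C (string p)) = (p + c) * s + 1"
    using assms(2) c by (intro num_leaves_attach_string) auto
  have "represents (attach ((p + c) * s) (string r) (string (p + c)))
      (attach ((p + c) * s) (string r) (attach i C (string p))) (from_string (attach i C (string p)))"
    by (intro represents_attach represents_from_string valid_string v l) (simp add: num_leaves_string)
  then show ?thesis
    using from_string_eqI[OF v] unfolding eq[symmetric] attach_string by blast
qed

lemma y_gen_eq: "y_gen n j p = from_string (attach (p * s) (caret (n j)) (string p))"
  by (simp add: y_gen_def num_leaves_string)

lemma z_gen_eq: "z_gen n j i = from_string (attach i (caret (n j)) (string (i div s + 1)))"
  by (simp add: z_gen_def s_def)

abbreviation "gens \<equiv> X k n"

lemma gens_from_string: "x \<in> gens \<Longrightarrow> \<exists>T. valid T \<and> x = from_string T"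
proof -
  have *: "valid (attach i (caret (n j)) (string p))" if "j \<in> {1..k}" for i j p
    using tree_of_types_attach(1)[OF valid_string valid_caret[OF that]] .
  assume "x \<in> gens"
  then obtain j i where "j \<in> {1..k}" "x = y_gen n j i \<or> x = z_gen n j i"
  proof -
    have "{2..k} \<subseteq> {1..k}" by auto
    then have "\<exists>j i. j \<in> {1..k} \<and> (x = y_gen n j i \<or> x = z_gen n j i)"
      using \<open>x \<in> gens\<close> unfolding X_def by blast
    then show ?thesis using that by blast
  qed
  then show ?thesis using *[of j] unfolding y_gen_eq z_gen_eq by blast
qed

lemma gens_closed: "gens \<subseteq> carrier H"
  using gens_from_string from_string_closed by blast

abbreviation "\<sigma> \<equiv> z_gen n 1 0"

lemma \<sigma>_in: "\<sigma> \<in> gens"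
  using n_ge[OF one_in] one_in unfolding X_def by fastforce

lemma \<sigma>_closed: "\<sigma> \<in> carrier H"
  using gens_closed \<sigma>_in by blast

text \<open>Both sides of the relation behind this lemma attach a caret at leaf \<open>0\<close> and \<open>C\<close> at leaf \<open>i\<close>.\<close>

lemma conjugate_from_string:
  assumes "valid C" "1 \<le> i" "i \<le> p * s"
  shows "H.conjugate \<sigma> (from_string (attach (i + s) C (string (Suc p)))) = from_string (attach i C (string p))"
proof -
  let ?c = "caret (n 1)"
  obtain c where c: "num_leaves C = c * s + 1" using num_leaves_valid[OF assms(1)] by blast
  have lc: "num_leaves ?c = 1 * s + 1" using num_leaves_string[of 1] by (simp add: caret_eq_string)
  have "valid ?c" using valid_caret one_in by blast
  have v: "valid (attach t E (string r))" if "valid E" for t r E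
    using that valid_string tree_of_types_attach(1) by blast
  have "0 < p" using assms by (cases p) auto
  have \<sigma>: "from_string (attach 0 ?c (string r)) = \<sigma>" if "0 < r" for r
    using from_string_stable[OF \<open>valid ?c\<close>, of 0 1 r] that s_pos by (simp add: z_gen_eq)
  have "attach 0 ?c (attach i C (string p)) = attach (i + s) C (attach 0 ?c (string p))"
    using attach_attach_commute(1)[of 0 i "string p" ?c C] assms lc by (simp add: num_leaves_string)
  moreover have "from_string (attach 0 ?c (attach i C (string p))) =
      from_string (attach i C (string p)) \<otimes>\<^bsub>H\<^esub> \<sigma>"
    using from_string_attach[OF v[OF assms(1)] \<open>valid ?c\<close> num_leaves_attach_string[OF assms(3) c], of 0]
      \<open>0 < p\<close> \<sigma> by simp
  moreover have "from_string (attach (i + s) C (attach 0 ?c (string p))) =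
      \<sigma> \<otimes>\<^bsub>H\<^esub> from_string (attach (i + s) C (string (Suc p)))"
    using from_string_attach[OF v[OF \<open>valid ?c\<close>] assms(1) num_leaves_attach_string[OF _ lc], of 0 p "i + s"]
      \<open>0 < p\<close> \<sigma> assms(3) by (simp add: Suc_eq_plus1 add_mult_distrib del: right_string.simps)
  ultimately show ?thesis
    using \<sigma>_closed from_string_closed[OF v[OF assms(1)]]
    unfolding H.conjugate_def by (metis H.inv_solve_right H.m_closed)
qed

lemma conjugate_power_from_string:
  assumes "valid C" "1 \<le> i" "i \<le> p * s"
  shows "(H.conjugate \<sigma> ^^ q) (from_string (attach (i + q * s) C (string (p + q)))) =
    from_string (attach i C (string p))"
proof (induction q)
  case (Suc q)
  have "H.conjugate \<sigma> (from_string (attach (i + q * s + s) C (string (Suc (p + q))))) =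
      from_string (attach (i + q * s) C (string (p + q)))"
    using assms by (intro conjugate_from_string) (auto simp: add_mult_distrib)
  then show ?case using Suc by (simp add: funpow_Suc_right add.commute add.left_commute del: funpow.simps)
qed simp

lemma last_caret_in_word_ball:
  assumes "j \<in> {1..k}" "p \<le> 1"
  shows "from_string (attach (p * s) (caret (n j)) (string p)) \<in> H.word_ball gens 1"
proof (cases "j = 1")
  case True
  then show ?thesis
    using H.one_in_word_ball by (simp only: caret_eq_string attach_string from_string_string)
next
  case False
  then have "y_gen n j p \<in> gens"
    using assms n_ge[OF assms(1)] by (force simp: X_def)
  then show ?thesis using H.generator_in_word_ball[OF gens_closed] by (simp add: y_gen_eq)
qed

lemma inner_caret_in_word_ball:
  assumes "j \<in> {1..k}" "i \<le> s"
  shows "from_string (attach i (caret (n j)) (string (i div s + 1))) \<in> H.word_ball gens 1"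
proof -
  have "z_gen n j i \<in> gens"
    using assms s_less[OF assms(1)] by (force simp: X_def)
  then show ?thesis using H.generator_in_word_ball[OF gens_closed] by (simp add: z_gen_eq)
qed

definition level :: "nat \<Rightarrow> nat" where "level i = (i - 1) div s"

lemma level_add: "level i \<le> level (i + m)" "level (i + m) \<le> level i + m"
proof -
  show "level i \<le> level (i + m)" unfolding level_def by (intro div_le_mono) simp
  have "level (i + m) \<le> (i - 1 + m * s) div s"
    unfolding level_def using s_pos by (intro div_le_mono) (cases s; simp)
  then show "level (i + m) \<le> level i + m" using s_pos by (simp add: level_def)
qed

lemma caret_in_word_ball:
  assumes "j \<in> {1..k}" "i \<le> p * s"
  shows "(H.conjugate \<sigma> ^^ level i) (from_string (attach i (caret (n j)) (string p))) \<in> H.word_ball gens 1"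
proof (cases "i = 0")
  case True
  show ?thesis
  proof (cases "p = 0")
    case True
    then show ?thesis
      using last_caret_in_word_ball[OF assms(1), of 0] \<open>i = 0\<close> by (simp add: level_def)
  next
    case False
    then have "from_string (attach 0 (caret (n j)) (string p)) = from_string (attach 0 (caret (n j)) (string 1))"
      using s_pos by (intro from_string_stable valid_caret assms) auto
    then show ?thesis
      using inner_caret_in_word_ball[OF assms(1), of 0] \<open>i = 0\<close> by (simp add: level_def)
  qed
next
  case False
  define q where "q = level i"
  define r where "r = i - q * s"
  have "i - 1 = q * s + (i - 1) mod s" "(i - 1) mod s < s"
    using s_pos by (auto simp: q_def level_def)
  then have i: "i = r + q * s" and r: "1 \<le> r" "r \<le> s"
    using False by (auto simp: r_def)
  have "q * s < p * s" using i r(1) assms(2) by linarith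
  then have "q < p" by simp
  then obtain l where l: "p = l + q" "1 \<le> l" using less_imp_add_positive[of q p] by (auto simp: add.commute)
  have "r \<le> l * s" using i l assms(2) by (simp add: add_mult_distrib)
  have "(H.conjugate \<sigma> ^^ q) (from_string (attach i (caret (n j)) (string p))) =
      from_string (attach r (caret (n j)) (string l))"
    unfolding i l(1) by (intro conjugate_power_from_string valid_caret assms r \<open>r \<le> l * s\<close>)
  moreover have "from_string (attach r (caret (n j)) (string l)) \<in> H.word_ball gens 1"
  proof (cases "r < l * s")
    case True
    then have "r div s < l" using s_pos by (simp add: div_less_iff_less_mult)
    moreover have "r < (r div s + 1) * s" using s_pos dividend_less_div_times[of s r] by (simp add: algebra_simps)
    ultimately have "from_string (attach r (caret (n j)) (string l)) =
        from_string (attach r (caret (n j)) (string (r div s + 1)))"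
      by (intro from_string_stable valid_caret assms) auto
    then show ?thesis using inner_caret_in_word_ball[OF assms(1) r(2)] by simp
  next
    case False
    then have "l * s \<le> 1 * s" "r = l * s" using r(2) \<open>r \<le> l * s\<close> by auto
    then have "l \<le> 1" using s_pos by (metis mult_le_cancel2)
    then show ?thesis using last_caret_in_word_ball[OF assms(1)] \<open>r = l * s\<close> by simp
  qed
  ultimately show ?thesis by (simp add: q_def)
qed

text \<open>
  The children of the root caret are attached from right to left, so that attaching one of them does
  not change the numbers of the leaves where the remaining ones are attached. As the level of a leaf
  exceeds that of its parent by at most \<open>K\<close>, the conjugating powers of \<open>\<sigma>\<close> contribute at most
  \<open>2 * K\<close> letters for each caret.
\<close>

lemma attach_in_word_ball:
  assumes K: "\<And>j. j \<in> {1..k} \<Longrightarrow> n j \<le> K"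
    and "valid C" "i \<le> p * s" "q \<le> level i" "level i \<le> q + K"
  shows "(H.conjugate \<sigma> ^^ q) (from_string (attach i C (string p)))
    \<in> H.word_ball gens ((2 * K + 1) * (num_leaves C - 1))"
  using assms(2-)
proof (induction C arbitrary: i p q)
  case Leaf
  then show ?case
    using H.conjugate_one[OF \<sigma>_closed] H.one_in_word_ball
    by (simp add: attach_Leaf from_string_string)
next
  case (Caret ts)
  obtain j where j: "j \<in> {1..k}" "length ts = n j" using Caret.prems by auto
  have pos: "1 \<le> num_leaves u" if "u \<in> set ts" for u
    using num_leaves_pos[of u] that Caret.prems(1) by auto
  have valid_sub: "valid (Caret (replicate m Leaf @ us))"
    if "m + length us = length ts" "set us \<subseteq> set ts" for m us
    using Caret.prems(1) that by auto
  have *: "(H.conjugate \<sigma> ^^ level i) (from_string (attach i (Caret (replicate m Leaf @ us)) (string p)))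
      \<in> H.word_ball gens (1 + (2 * K + 1) * (\<Sum>u\<leftarrow>us. num_leaves u - 1))"
    if "m + length us = length ts" "set us \<subseteq> set ts" for m us
    using that
  proof (induction us arbitrary: m)
    case Nil
    then show ?case
      using caret_in_word_ball[OF j(1) Caret.prems(2)] j by (simp add: caret_def)
  next
    case (Cons u us)
    define E where "E = Caret (replicate (Suc m) Leaf @ us)"
    have E: "valid E" unfolding E_def using Cons.prems by (intro valid_sub) auto
    obtain c where c: "num_leaves E = c * s + 1" using num_leaves_valid[OF E] by blast
    have "m < num_leaves E" by (simp add: E_def sum_list_replicate)
    then have m: "i + m \<le> (p + c) * s"
      using Caret.prems(2) c by (simp add: add_mult_distrib)
    have "valid u" using Cons.prems Caret.prems(1) by auto
    have v: "valid (attach i E (string p))"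
      using E valid_string tree_of_types_attach(1) by blast
    have "attach i (Caret (replicate m Leaf @ u # us)) (string p) =
        attach (i + m) u (attach i E (string p))"
      using attach_attach_nested(1)[of i "string p" m E u] \<open>m < num_leaves E\<close> Caret.prems(2)
        attach_caret_Leaf[of m u us] by (simp add: E_def num_leaves_string)
    then have "from_string (attach i (Caret (replicate m Leaf @ u # us)) (string p)) =
        from_string (attach i E (string p)) \<otimes>\<^bsub>H\<^esub> from_string (attach (i + m) u (string (p + c)))"
      using from_string_attach[OF v \<open>valid u\<close> num_leaves_attach_string[OF Caret.prems(2) c] m] by simp
    moreover have u: "(H.conjugate \<sigma> ^^ level i) (from_string (attach (i + m) u (string (p + c))))
        \<in> H.word_ball gens ((2 * K + 1) * (num_leaves u - 1))"
      using Cons.prems level_add[of i m] K[OF j(1)] j(2) m \<open>valid u\<close> by (intro Caret.IH) auto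
    moreover have us: "(H.conjugate \<sigma> ^^ level i) (from_string (attach i E (string p)))
        \<in> H.word_ball gens (1 + (2 * K + 1) * (\<Sum>u\<leftarrow>us. num_leaves u - 1))"
      unfolding E_def using Cons.prems by (intro Cons.IH) auto
    moreover have "from_string (attach i E (string p)) \<in> carrier H"
        "from_string (attach (i + m) u (string (p + c))) \<in> carrier H"
      using v tree_of_types_attach(1)[OF valid_string \<open>valid u\<close>] by (blast intro: from_string_closed)+
    ultimately show ?case
      using H.word_ball_mult[OF gens_closed us u] H.conjugate_mult[OF \<sigma>_closed]
      by (simp add: algebra_simps)
  qed
  let ?x = "(H.conjugate \<sigma> ^^ q) (from_string (attach i (Caret ts) (string p)))"
  let ?l = "1 + (2 * K + 1) * (\<Sum>u\<leftarrow>ts. num_leaves u - 1)"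
  have "(H.conjugate \<sigma> ^^ (level i - q)) ?x \<in> H.word_ball gens ?l"
    using *[of 0 ts] Caret.prems(3) by (simp flip: funpow_add[THEN fun_cong, unfolded comp_def])
  moreover have "?x \<in> carrier H"
    using Caret.prems(1) tree_of_types_attach(1)[OF valid_string]
    by (intro H.conjugate_closed \<sigma>_closed from_string_closed) blast
  ultimately have "?x \<in> H.word_ball gens (?l + 2 * (level i - q))"
    using H.word_ball_unconjugate[OF gens_closed \<sigma>_in] by blast
  moreover have "?l + 2 * (level i - q) \<le> (2 * K + 1) * (num_leaves (Caret ts) - 1)"
  proof -
    have "(\<Sum>u\<leftarrow>us. num_leaves u - 1) + length us = (\<Sum>u\<leftarrow>us. num_leaves u)"
      if "set us \<subseteq> set ts" for us
      using that
    proof (induction us)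
      case (Cons u us)
      then show ?case using pos[of u] by simp
    qed simp
    then have "(\<Sum>u\<leftarrow>ts. num_leaves u - 1) + 1 \<le> num_leaves (Caret ts) - 1"
      using j n_ge[OF j(1)] by force
    then have "(2 * K + 1) * ((\<Sum>u\<leftarrow>ts. num_leaves u - 1) + 1) \<le> (2 * K + 1) * (num_leaves (Caret ts) - 1)"
      by (rule mult_le_mono2)
    moreover have le: "1 + c * x + 2 * d \<le> c * (x + 1)" if "1 + 2 * d \<le> c" for c d x :: nat
      using that by (simp add: One_nat_def)
    have "?l + 2 * (level i - q) \<le> (2 * K + 1) * ((\<Sum>u\<leftarrow>ts. num_leaves u - 1) + 1)"
      using Caret.prems(4) by (intro le) simp
    ultimately show ?thesis by (rule le_trans[rotated])
  qed
  ultimately show ?case using H.word_ball_mono by blast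
qed

lemma carrier_in_word_ball:
  assumes K: "\<And>j. j \<in> {1..k} \<Longrightarrow> n j \<le> K"
    and "w \<in> F_carrier k n"
  shows "w \<in> H.word_ball gens (2 * (2 * K + 1) * L k n w)"
proof -
  have "\<exists>l S T. valid S \<and> valid T \<and> represents S T w \<and> num_leaves S = l"
    using diagram_exists[OF assms(2)] by blast
  from LeastI_ex[OF this] obtain S T where S: "valid S" "num_leaves S = L k n w"
    and T: "valid T" and w: "represents S T w"
    unfolding L_def by blast
  have leaves: "num_leaves T = num_leaves S" using w by (simp add: represents_def)
  obtain p where p: "num_leaves S = p * s + 1" using num_leaves_valid[OF S(1)] by blast
  have "represents (string p) T (w \<otimes>\<^bsub>H\<^esub> from_string S)"
    using represents_mult[OF valid_string S(1) T represents_from_string[OF S(1) p] w] .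
  then have "from_string T = w \<otimes>\<^bsub>H\<^esub> from_string S"
    by (rule from_string_eqI[OF T])
  moreover have "w \<in> carrier H"
    using represents_in_Bij[OF S(1) T w] by (simp add: BijGroup_def)
  ultimately have w_eq: "w = from_string T \<otimes>\<^bsub>H\<^esub> inv\<^bsub>H\<^esub> from_string S"
    using from_string_closed[OF S(1)] by (simp add: H.m_assoc)
  have *: "from_string U \<in> H.word_ball gens ((2 * K + 1) * (num_leaves U - 1))" if "valid U" for U
    using attach_in_word_ball[OF K that, of 0 0 0] by (simp add: level_def)
  have "w \<in>
      H.word_ball gens ((2 * K + 1) * (num_leaves T - 1) + (2 * K + 1) * (num_leaves S - 1))"
    unfolding w_eq by (intro H.word_ball_mult H.word_ball_inv gens_closed * S T)
  moreover have le: "c * (l - 1) + c * (l - 1) \<le> 2 * c * l" for c l :: nat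
  proof -
    have "c * (l - 1) \<le> c * l" by (rule mult_le_mono2) simp
    from add_mono[OF this this] show ?thesis by (simp only: mult_2 add_mult_distrib)
  qed
  ultimately show ?thesis
    using H.word_ball_mono[OF le] unfolding leaves S(2) by blast
qed

lemma inv_F:
  assumes "x \<in> gens"
  shows "inv\<^bsub>F k n\<^esub> x = inv\<^bsub>H\<^esub> x"
proof -
  obtain T where T: "valid T" "x = from_string T" using gens_from_string[OF assms] by blast
  obtain p where p: "num_leaves T = p * s + 1" using num_leaves_valid[OF T(1)] by blast
  have x: "represents (string p) T x"
    using represents_from_string[OF T(1) p] T(2) by simp
  have y: "represents T (string p) (diagram_map T (string p))" (is "represents _ _ ?y")
    by (intro represents_diagram_map T valid_string) (simp add: p num_leaves_string)
  have carrier: "?y \<in> F_carrier k n" using represents_in_F_carrier[OF T(1) valid_string y] .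
  have "?y \<otimes>\<^bsub>H\<^esub> x = \<one>\<^bsub>H\<^esub>"
    using represents_unique[OF valid_string represents_mult[OF valid_string T(1) valid_string x y]
        represents_refl[OF valid_string]] by (simp add: BijGroup_def)
  moreover have "F_carrier k n \<subseteq> carrier H"
    by (auto simp: F_carrier_def BijGroup_def)
  ultimately have "?y = inv\<^bsub>H\<^esub> x"
    using H.inv_equality[of ?y x] carrier gens_closed assms by (metis subsetD)
  then have inv: "inv\<^bsub>H\<^esub> x \<in> F_carrier k n" using carrier by simp
  have "x \<in> carrier H" using gens_closed assms by blast
  show ?thesis
    unfolding m_inv_def[of "F k n"]
  proof (rule the_equality)
    show "inv\<^bsub>H\<^esub> x \<in> carrier (F k n) \<and> x \<otimes>\<^bsub>F k n\<^esub> inv\<^bsub>H\<^esub> x = \<one>\<^bsub>F k n\<^esub> \<and>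
        inv\<^bsub>H\<^esub> x \<otimes>\<^bsub>F k n\<^esub> x = \<one>\<^bsub>F k n\<^esub>"
      using inv \<open>x \<in> carrier H\<close> by (simp add: F_def)
    show "z = inv\<^bsub>H\<^esub> x"
      if "z \<in> carrier (F k n) \<and> x \<otimes>\<^bsub>F k n\<^esub> z = \<one>\<^bsub>F k n\<^esub> \<and> z \<otimes>\<^bsub>F k n\<^esub> x = \<one>\<^bsub>F k n\<^esub>" for z
      using that \<open>x \<in> carrier H\<close> \<open>F_carrier k n \<subseteq> carrier H\<close> H.inv_equality[of z x]
      by (auto simp: F_def)
  qed
qed

lemma word_length_le:
  assumes "w \<in> H.word_ball gens m"
  shows "word_length (F k n) gens w \<le> enat m"
proof -
  obtain ws where ws: "set ws \<subseteq> gens \<union> m_inv H ` gens" "foldr (\<otimes>\<^bsub>H\<^esub>) ws \<one>\<^bsub>H\<^esub> = w" "length ws \<le> m"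
    using assms by (auto simp: H.word_ball_def)
  have "m_inv (F k n) ` gens = m_inv H ` gens"
    using inv_F by simp
  then have "ws \<in> {ws. set ws \<subseteq> gens \<union> m_inv (F k n) ` gens \<and> foldr (mult (F k n)) ws (one (F k n)) = w}"
    using ws by (simp add: F_def)
  then have "word_length (F k n) gens w \<le> enat (length ws)"
    unfolding word_length_def by (rule INF_lower)
  also have "\<dots> \<le> enat m" using ws(3) by simp
  finally show ?thesis .
qed

end

theorem corollary5p1:
  fixes k :: nat and n :: "nat \<Rightarrow> nat"
  assumes "k \<ge> 1"
    and "\<And>j. j \<in> {1..k} \<Longrightarrow> n j \<ge> 2"
    and "\<And>j. j \<in> {1..k} \<Longrightarrow> n 1 - 1 dvd n j - 1"
  shows "\<exists>d::nat. \<forall>w \<in> carrier (F k n).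
    word_length (F k n) (X k n) w \<le> enat (d * L k n w)"
proof -
  interpret parameters k n
    by unfold_locales (use assms in auto)
  have "n j \<le> Max (n ` {1..k})" if "j \<in> {1..k}" for j
    using that by simp
  then have "word_length (F k n) (X k n) w \<le> enat (2 * (2 * Max (n ` {1..k}) + 1) * L k n w)"
    if "w \<in> carrier (F k n)" for w
    using that by (intro word_length_le carrier_in_word_ball) (auto simp: F_def)
  then show ?thesis by blast
qed

end
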